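(* Let $A\subset\mathbb{N}$ and suppose that there exists a constant $\gamma>0$ such that \[ \#\big(A \cap [0,n]\big) \geq \frac{n}{(\log n)^\gamma} \] for infinitely many $n \in \mathbb{N}$. Then, for all $\alpha\in (0,1)$, all integers $k \geq 1$ and all $\Delta_0>1$, there exist infinitely many arithmetic progressions $P$ of length $k$ and gap length $\Delta \geq \Delta_0$ such that \[ \sup_{p \in P} \inf_{a \in A} |p-a| \leq \Delta^\alpha. \] Moreover, there is a constant $c>0$, depending only on $\alpha$ and $\gamma$, such that for infinitely many $n \in\mathbb{N}$, such a progression $P$ (of length $k$, with gap length $\Delta\ge\Delta_0$ and satisfying the displayed inequality) can be chosen to have gap length $\Delta$ at least $cn$ and to lie in the interval $\big[2^n, \, 2^{n+1}\big]$.
   Context: $\mathbb{N}$ denotes the set of positive integers, and $\#E$ denotes the cardinality of a finite set $E$. An arithmetic progression of length $k\in\mathbb{N}$ and gap length $\Delta>0$ is a set of real numbers of the form $\{a, a+\Delta, \dots, a+(k-1)\Delta\}\subset\mathbb{R}$; it is a subset of $\mathbb{R}$, so its elements and its gap length need not be integers. *)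

theory Defs
  imports Complex_Main
begin

text \<open>For \<open>k = 1\<close> the set \<open>P\<close> is a singleton and every \<open>\<Delta> > 0\<close> is a gap length of it.\<close>

definition is_arith_prog :: "nat \<Rightarrow> real \<Rightarrow> real set \<Rightarrow> bool" where
  "is_arith_prog k \<Delta> P \<longleftrightarrow> k \<ge> 1 \<and> \<Delta> > 0 \<and> (\<exists>a::real. P = {a + real i * \<Delta> | i. i < k})"

definition approximates_AP :: "nat set \<Rightarrow> real \<Rightarrow> nat \<Rightarrow> real \<Rightarrow> real set \<Rightarrow> bool" where
  "approximates_AP A \<alpha> k \<Delta> P \<longleftrightarrow>
     is_arith_prog k \<Delta> P \<and> (SUP p\<in>P. INF a\<in>A. \<bar>p - real a\<bar>) \<le> \<Delta> powr \<alpha>"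

end

theory Submission
  imports Defs "HOL-Library.Countable" "HOL-Library.Infinite_Set" "HOL-Real_Asymp.Real_Asymp"
begin

text \<open>Infinitely many dyadic blocks \<open>[2\<^sup>n, 2\<^sup>n\<^sup>+\<^sup>1)\<close> contain a proportion at least \<open>n powr -(\<gamma> + 1)\<close> of points of \<open>A\<close>.
  In such a block let \<open>M b\<close> be the number of dyadic cells of length \<open>2\<^sup>b\<close> meeting \<open>A\<close>. A \<open>k\<close>-term progression of cells
  of length \<open>2\<^sup>b\<close> with gap \<open>\<Delta>\<close> at least \<open>2 powr (b / \<alpha>)\<close> gives a progression within \<open>\<Delta> powr \<alpha>\<close> of \<open>A\<close>. If there is none,
  Szemeredi's theorem yields \<open>M b \<le> \<epsilon> 2\<^sup>a\<^sup>-\<^sup>b M a\<close> for \<open>a\<close> about \<open>b / \<alpha>\<close>. Iterating from \<open>b\<close> of order \<open>sqrt n\<close> up to \<open>n\<close>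
  takes about \<open>log n / (2 log (2 / \<alpha>))\<close> steps, so for \<open>\<epsilon>\<close> small in terms of \<open>\<alpha>\<close> and \<open>\<gamma>\<close> the proportion of \<open>A\<close> would
  be smaller than \<open>n powr -(\<gamma> + 1)\<close>.

  Szemeredi's theorem in turn follows from the density Hales--Jewett theorem, proved by induction on the
  size of the alphabet with the density increment method of Polymath in the form given by Dodos,
  Kanellopoulos and Tyros: a line-free set over \<open>k + 1\<close> letters of almost critical density would be denser on
  an intersection of \<open>k\<close> sets, the \<open>i\<close>-th of them insensitive to exchanging the letters \<open>i\<close> and \<open>k\<close>. By the
  theorem for \<open>k\<close> letters such intersections are nearly partitioned into subspaces, on one of which the
  set would then exceed the critical density.\<close>

section \<open>Words and combinatorial subspaces\<close>

definition words :: "nat \<Rightarrow> nat \<Rightarrow> nat list set" where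
  "words k n = {x. set x \<subseteq> {..<k} \<and> length x = n}"

text \<open>In a template a symbol \<open>s < k\<close> is a letter and \<open>k + j\<close> is the \<open>j\<close>-th variable. Hence \<open>tmpl k m n\<close> encodes the
  \<open>m\<close>-dimensional combinatorial subspaces, and a combinatorial line over \<open>k\<close> letters is the same thing as
  a word over \<open>k + 1\<close> letters in which the letter \<open>k\<close> (the wildcard) occurs.\<close>

definition tmpl :: "nat \<Rightarrow> nat \<Rightarrow> nat \<Rightarrow> nat list set" where
  "tmpl k m n = {T. set T \<subseteq> {..<k+m} \<and> {k..<k+m} \<subseteq> set T \<and> length T = n}"

text \<open>The third argument may be a word or again a template, so the same operation evaluates a
  subspace at a point and composes subspaces.\<close>

definition sub :: "nat \<Rightarrow> nat list \<Rightarrow> nat list \<Rightarrow> nat list" where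
  "sub k T w = map (\<lambda>s. if s < k then s else w ! (s - k)) T"

lemma finite_words [simp]: "finite (words k n)"
  unfolding words_def by (rule finite_lists_length_eq) simp

lemma card_words [simp]: "card (words k n) = k ^ n"
  unfolding words_def by (subst card_lists_length_eq) auto

lemma finite_tmpl [simp]: "finite (tmpl k m n)"
proof (rule finite_subset)
  show "tmpl k m n \<subseteq> words (k + m) n" by (auto simp: tmpl_def words_def)
qed (rule finite_words)

lemma words_0 [simp]: "words k 0 = {[]}"
  by (auto simp: words_def)

lemma length_words: "x \<in> words k n \<Longrightarrow> length x = n"
  by (simp add: words_def)

lemma words_mono: "x \<in> words k n \<Longrightarrow> k \<le> l \<Longrightarrow> x \<in> words l n"
  by (auto simp: words_def)

lemma append_words: "x \<in> words k n \<Longrightarrow> y \<in> words k m \<Longrightarrow> x @ y \<in> words k (n + m)"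
  by (auto simp: words_def)

lemma words_append_image: "words k (n + m) = (\<lambda>(x, y). x @ y) ` (words k n \<times> words k m)"
proof (intro equalityI subsetI)
  fix z assume z: "z \<in> words k (n + m)"
  hence "take n z \<in> words k n" "drop n z \<in> words k m"
    by (auto simp: words_def dest: in_set_takeD in_set_dropD)
  thus "z \<in> (\<lambda>(x, y). x @ y) ` (words k n \<times> words k m)"
    by (intro image_eqI[where x = "(take n z, drop n z)"]) auto
qed (auto simp: append_words)

lemma inj_on_append: "inj_on (\<lambda>(x, y). x @ y) (words k n \<times> words l m)"
  by (auto simp: inj_on_def words_def)

lemma sum_words_append:
  "(\<Sum>x\<in>words k (n + m). f x) = (\<Sum>x\<in>words k n. \<Sum>y\<in>words k m. f (x @ y))"
  unfolding words_append_image sum.cartesian_product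
  by (subst sum.reindex[OF inj_on_append]) (simp add: case_prod_unfold o_def)

lemma sum_words_append':
  "(\<Sum>x\<in>words k (n + m). f x) = (\<Sum>y\<in>words k m. \<Sum>x\<in>words k n. f (x @ y))"
  by (simp add: sum_words_append sum.swap[of _ "words k n"])

lemma words_1: "words k (Suc 0) = (\<lambda>a. [a]) ` {..<k}"
  by (auto simp: words_def length_Suc_conv)

lemma sum_words_1: "(\<Sum>x\<in>words k (Suc 0). f x) = (\<Sum>a<k. f [a])"
  unfolding words_1 by (subst sum.reindex) (auto simp: inj_on_def)

text \<open>Words are the zero-dimensional templates, so facts on composing templates also cover
  evaluation.\<close>

lemma words_eq_tmpl: "words k n = tmpl k 0 n"
  by (auto simp: words_def tmpl_def)

lemma sub_tmpl:
  assumes T: "T \<in> tmpl k m n" and U: "U \<in> tmpl k p m"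
  shows "sub k T U \<in> tmpl k p n"
proof -
  have l: "length U = m" "length T = n" using assms by (auto simp: tmpl_def)
  have "set (sub k T U) \<subseteq> {..<k+p}"
  proof
    fix s assume "s \<in> set (sub k T U)"
    then obtain t where t: "t \<in> set T" "s = (if t < k then t else U ! (t - k))"
      by (auto simp: sub_def)
    show "s \<in> {..<k+p}"
    proof (cases "t < k")
      case False
      hence "t - k < length U" using t T l by (auto simp: tmpl_def)
      hence "U ! (t - k) \<in> set U" by simp
      thus ?thesis using t U False by (auto simp: tmpl_def)
    qed (use t in auto)
  qed
  moreover have "{k..<k+p} \<subseteq> set (sub k T U)"
  proof
    fix s assume "s \<in> {k..<k+p}"
    hence "s \<in> set U" using U by (auto simp: tmpl_def)
    then obtain j where j: "j < m" "s = U ! j" using l by (metis in_set_conv_nth)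
    hence "k + j \<in> set T" using T by (auto simp: tmpl_def)
    thus "s \<in> set (sub k T U)" using j unfolding sub_def set_map
      by (intro image_eqI[where x = "k + j"]) auto
  qed
  ultimately show ?thesis using l by (simp add: tmpl_def sub_def)
qed

lemma sub_words: "T \<in> tmpl k m n \<Longrightarrow> w \<in> words k m \<Longrightarrow> sub k T w \<in> words k n"
  by (simp add: words_eq_tmpl sub_tmpl)

lemma sub_sub:
  assumes "T \<in> tmpl k m n" and "length U = m"
  shows "sub k (sub k T U) w = sub k T (sub k U w)"
  using assms by (auto simp: sub_def tmpl_def)

lemma sub_append: "sub k (S @ T) w = sub k S w @ sub k T w"
  by (simp add: sub_def)

lemma sub_const: "set x \<subseteq> {..<k} \<Longrightarrow> sub k x w = x"
  unfolding sub_def by (rule map_idI) auto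

lemma sub_words_const: "x \<in> words k n \<Longrightarrow> sub k x w = x"
  by (rule sub_const) (auto simp: words_def)

lemma sub_vars: "sub k [k..<k + length w] w = w"
  by (rule nth_equalityI) (auto simp: sub_def)

lemma sub_vars_append1: "length u = j \<Longrightarrow> sub k [k..<k + j] (u @ w) = u"
  by (rule nth_equalityI) (auto simp: sub_def nth_append)

lemma vars_tmpl: "[k..<k+m] \<in> tmpl k m m"
  by (auto simp: tmpl_def)

text \<open>Every variable occurs in a template, so each letter of \<open>w\<close> can be read off
  from the image.\<close>

lemma inj_on_sub:
  assumes T: "T \<in> tmpl k m n"
  shows "inj_on (sub k T) (words k m)"
proof (rule inj_onI)
  fix w w' assume w: "w \<in> words k m" "w' \<in> words k m" and eq: "sub k T w = sub k T w'"
  show "w = w'"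
  proof (rule nth_equalityI)
    show "length w = length w'" using w by (simp add: words_def)
    fix j assume "j < length w"
    hence "k + j \<in> set T" using T w by (auto simp: tmpl_def words_def)
    moreover have "\<forall>s\<in>set T. (if s < k then s else w ! (s - k)) = (if s < k then s else w' ! (s - k))"
      using eq by (simp add: sub_def)
    ultimately have "(if k + j < k then k + j else w ! (k + j - k)) = (if k + j < k then k + j else w' ! (k + j - k))"
      by (rule bspec[rotated])
    thus "w ! j = w' ! j" by simp
  qed
qed

lemma tmpl_append_words: "T \<in> tmpl k m n \<Longrightarrow> x \<in> words k p \<Longrightarrow> T @ x \<in> tmpl k m (n + p)"
  by (auto simp: tmpl_def words_def)

lemma words_append_tmpl: "T \<in> tmpl k m n \<Longrightarrow> x \<in> words k p \<Longrightarrow> x @ T \<in> tmpl k m (p + n)"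
  by (auto simp: tmpl_def words_def)

section \<open>Products of subspaces and change of alphabet\<close>

definition shift_vars :: "nat \<Rightarrow> nat \<Rightarrow> nat list \<Rightarrow> nat list" where
  "shift_vars k j T = map (\<lambda>s. if s < k then s else s + j) T"

lemma length_shift_vars [simp]: "length (shift_vars k j T) = length T"
  by (simp add: shift_vars_def)

lemma sub_shift_vars: "length u = j \<Longrightarrow> sub k (shift_vars k j T) (u @ w) = sub k T w"
  by (auto simp: sub_def shift_vars_def nth_append)

lemma set_shift_vars:
  assumes "T \<in> tmpl k m n"
  shows "{k+j..<k+j+m} \<subseteq> set (shift_vars k j T)" "set (shift_vars k j T) \<subseteq> {..<k} \<union> {k+j..<k+j+m}"
proof
  fix s assume "s \<in> {k+j..<k+j+m}"
  hence "s - j \<in> {k..<k+m}" "s - j \<ge> k" "s = (s - j) + j" by auto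
  hence "s - j \<in> set T" "s - j \<ge> k" "s = (s - j) + j" using assms unfolding tmpl_def by blast+
  thus "s \<in> set (shift_vars k j T)" unfolding shift_vars_def set_map
    by (intro image_eqI[where x = "s - j"]) auto
next
  have "t < k + m" if "t \<in> set T" for t using assms that by (auto simp: tmpl_def)
  thus "set (shift_vars k j T) \<subseteq> {..<k} \<union> {k+j..<k+j+m}"
    by (auto simp: shift_vars_def add.commute add.left_commute)
qed

text \<open>Renumbering separates the variables of the two factors, so the concatenation is a
  product of subspaces and dimensions add.\<close>

lemma tmpl_append_shift:
  assumes S: "S \<in> tmpl k m n" and T: "T \<in> tmpl k m' n'"
  shows "S @ shift_vars k m T \<in> tmpl k (m + m') (n + n')"
proof -
  have *: "{k..<k+(m+m')} = {k..<k+m} \<union> {k+m..<k+m+m'}" by auto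
  have "{..<k+m} \<subseteq> {..<k+(m+m')}" "{..<k} \<union> {k+m..<k+m+m'} \<subseteq> {..<k+(m+m')}" by auto
  thus ?thesis using S T set_shift_vars[OF T, of m] unfolding tmpl_def mem_Collect_eq set_append *
    by (auto intro: order_trans)
qed

lemma sub_append_shift:
  assumes S: "S \<in> tmpl k m n" and u: "length u = m"
  shows "sub k (S @ shift_vars k m T) (u @ w) = sub k S u @ sub k T w"
proof -
  have "sub k S (u @ w) = sub k S u" using S u by (auto simp: sub_def tmpl_def nth_append)
  thus ?thesis by (simp add: sub_append sub_shift_vars[OF u])
qed

text \<open>\<open>shift_vars k 1\<close> rereads a template over the alphabet of size \<open>k + 1\<close>: the symbol \<open>k\<close> turns from
  a variable into a letter.\<close>

lemma lift_tmpl: "T \<in> tmpl k m n \<Longrightarrow> shift_vars k 1 T \<in> tmpl (Suc k) m n"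
proof -
  assume T: "T \<in> tmpl k m n"
  have "{..<k} \<union> {k+1..<k+1+m} \<subseteq> {..<Suc k + m}" by auto
  moreover have "Suc k = k + 1" by simp
  ultimately show ?thesis using set_shift_vars[OF T, of 1] T
    unfolding tmpl_def mem_Collect_eq by (metis length_shift_vars order_trans)
qed

lemma sub_lift: "sub (Suc k) (shift_vars k 1 T) w = sub k T w"
  by (auto simp: sub_def shift_vars_def)

text \<open>Two words have the same image under \<open>map (merge k i)\<close> iff they differ only
  by exchanges of the letters \<open>i\<close> and \<open>k\<close>. For \<open>i < k\<close> the
  image of a word over \<open>k + 1\<close> letters is a word over \<open>k\<close> letters.\<close>

definition merge :: "nat \<Rightarrow> nat \<Rightarrow> nat \<Rightarrow> nat" where
  "merge k i s = (if s = k then i else s)"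

text \<open>\<open>merge k i\<close> is idempotent, so merging the substituted letters beforehand
  changes nothing once the result is merged.\<close>

lemma map_merge_sub:
  assumes "T \<in> tmpl (Suc k) m n" "length w = m"
  shows "map (merge k i) (sub (Suc k) T (map (merge k i) w)) = map (merge k i) (sub (Suc k) T w)"
proof -
  have "t - Suc k < length w" if "t \<in> set T" "\<not> t < Suc k" for t
    using that assms by (auto simp: tmpl_def)
  thus ?thesis by (auto simp: sub_def merge_def)
qed

text \<open>Only a constant \<open>k\<close> of \<open>T\<close> could be changed by merging after
  the substitution but not before it. This is why the subspaces below are required to have no
  constant \<open>k\<close>.\<close>

lemma map_merge_sub_no_const:
  assumes "T \<in> tmpl (Suc k) m n" "length w = m" "k \<notin> set T"
  shows "map (merge k i) (sub (Suc k) T w) = sub (Suc k) T (map (merge k i) w)"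
proof -
  have "t - Suc k < length w" if "t \<in> set T" "\<not> t < Suc k" for t
    using that assms by (auto simp: tmpl_def)
  thus ?thesis using assms(3) by (auto simp: sub_def merge_def)
qed

lemma map_merge_words: "i < k \<Longrightarrow> x \<in> words (Suc k) n \<Longrightarrow> map (merge k i) x \<in> words k n"
  by (fastforce simp: words_def merge_def)

text \<open>A line over \<open>k\<close> letters, viewed as a word over \<open>k + 1\<close>
  letters, has its points given by merging the wildcard \<open>k\<close> into each
  \<open>i\<close>.\<close>

lemma sub_eq_map_merge: "x \<in> words (Suc k) n \<Longrightarrow> sub k x [i] = map (merge k i) x"
  by (fastforce simp: sub_def merge_def words_def less_Suc_eq)

text \<open>As \<open>f \<le> 1\<close>, a mean of at least \<open>\<gamma>\<close> forces
  \<open>f x \<ge> \<gamma> / 2\<close> for a proportion \<open>\<gamma> / 2\<close> of the points;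
  some \<open>t\<close> serves a share \<open>1 / card Ts\<close> of these. The lemma makes the
  choice of a line or subspace uniform over many sections.\<close>

lemma markov_pigeonhole:
  fixes f :: "'a \<Rightarrow> real" and \<gamma> :: real
  assumes fin: "finite X" "finite Ts" and X: "X \<noteq> {}" and \<gamma>: "\<gamma> > 0"
    and f: "\<And>x. x \<in> X \<Longrightarrow> f x \<le> 1" and avg: "(\<Sum>x\<in>X. f x) \<ge> \<gamma> * card X"
    and R: "\<And>x. x \<in> X \<Longrightarrow> f x \<ge> \<gamma> / 2 \<Longrightarrow> \<exists>t\<in>Ts. R x t"
  obtains t where "t \<in> Ts" "card {x\<in>X. R x t} \<ge> \<gamma> / (2 * card Ts) * card X"
proof -
  define Y where "Y = {x\<in>X. f x \<ge> \<gamma> / 2}"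
  have finY: "finite Y" and YX: "Y \<subseteq> X" using fin by (auto simp: Y_def)
  have "(\<Sum>x\<in>X. f x) \<le> (\<Sum>x\<in>X. of_bool (x \<in> Y) + \<gamma> / 2)"
    by (rule sum_mono) (use f \<gamma> in \<open>fastforce simp: Y_def\<close>)
  also have "\<dots> = card Y + \<gamma> / 2 * card X"
    using fin YX by (simp add: sum.distrib Int_absorb1)
  finally have Y: "card Y \<ge> \<gamma> / 2 * card X" using avg by simp
  have "Y \<subseteq> (\<Union>t\<in>Ts. {x\<in>X. R x t})" using R by (auto simp: Y_def)
  hence "card Y \<le> (\<Sum>t\<in>Ts. card {x\<in>X. R x t})"
    using fin by (intro order_trans[OF card_mono card_UN_le]) auto
  hence le: "\<gamma> / 2 * card X \<le> (\<Sum>t\<in>Ts. real (card {x\<in>X. R x t}))"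
    using Y by (simp flip: of_nat_sum)
  have cX: "card X > 0" using fin X by (simp add: card_gt_0_iff)
  have "\<gamma> / 2 * card X > 0" using cX \<gamma> by simp
  hence "Ts \<noteq> {}" using le by auto
  hence cT: "card Ts > 0" using fin by (simp add: card_gt_0_iff)
  show ?thesis
  proof (rule ccontr)
    assume "\<not> ?thesis"
    hence "\<And>t. t \<in> Ts \<Longrightarrow> real (card {x\<in>X. R x t}) < \<gamma> / (2 * card Ts) * card X"
      using that not_le by metis
    hence "(\<Sum>t\<in>Ts. real (card {x\<in>X. R x t})) < (\<Sum>t\<in>Ts. \<gamma> / (2 * card Ts) * card X)"
      using fin \<open>Ts \<noteq> {}\<close> by (intro sum_strict_mono) auto
    also have "\<dots> = \<gamma> / 2 * card X" using cT by simp
    finally show False using le by simp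
  qed
qed

lemma real_card_eq_sum: "finite X \<Longrightarrow> A \<subseteq> X \<Longrightarrow> real (card A) = (\<Sum>x\<in>X. of_bool (x \<in> A))"
  by (simp add: Int_absorb1)

section \<open>The Hales--Jewett theorem\<close>

lemma tmpl_block: "i < k \<Longrightarrow> j < k \<Longrightarrow> a < b \<Longrightarrow> b \<le> N \<Longrightarrow>
  replicate a i @ replicate (b - a) k @ replicate (N - b) j \<in> tmpl k 1 N"
  by (auto simp: tmpl_def)

lemma sub_Cons_shift:
  "S \<in> tmpl k 1 n \<Longrightarrow> sub k (S @ shift_vars k 1 T) (a # w) = sub k S [a] @ sub k T w"
  using sub_append_shift[of S k 1 n "[a]" T w] by simp

text \<open>A list of colours serves as a single colour of a new colouring. It is encoded as a
  number because the inductions keep the colour type \<open>nat\<close> fixed.\<close>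

lemma finite_to_nat_lists:
  "finite C \<Longrightarrow> finite (to_nat ` {l :: nat list. set l \<subseteq> C \<and> length l = n})"
  by (intro finite_imageI finite_lists_length_eq)

text \<open>Shelah's step: among the \<open>N + 1\<close> words \<open>(k-1)\<^sup>a k\<^sup>N\<^sup>-\<^sup>a\<close> two are indistinguishable, and the
  block between them is a line on which the letters \<open>k - 1\<close> and \<open>k\<close> are interchangeable.\<close>

lemma shelah_insensitive:
  assumes k: "0 < k" and C: "finite C"
  shows "\<exists>n. \<forall>c::nat list \<Rightarrow> nat. (\<forall>x\<in>words (Suc k) n. c x \<in> C) \<longrightarrow>
    (\<exists>T\<in>tmpl (Suc k) m n. \<forall>w\<in>words (Suc k) m.
       c (sub (Suc k) T w) = c (sub (Suc k) T (map (merge k (k - 1)) w)))"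
  using C
proof (induction m arbitrary: C)
  case 0
  have "[] \<in> tmpl (Suc k) 0 0" by (simp add: tmpl_def)
  thus ?case by (intro exI[of _ 0] allI impI bexI[of _ "[]"]) auto
next
  case (Suc m)
  let ?K = "Suc k" and ?\<mu> = "merge k (k - 1)"
  \<comment> \<open>The new colour of a tail will list the \<open>k + 1\<close> values of
    \<open>c\<close> obtained by putting the points of one line in front of the tail.\<close>
  define C1 where "C1 = to_nat ` {l :: nat list. set l \<subseteq> C \<and> length l = ?K}"
  have "finite C1" unfolding C1_def by (rule finite_to_nat_lists[OF Suc.prems])
  from Suc.IH[OF this] obtain n where n: "\<And>c::nat list \<Rightarrow> nat. (\<forall>x\<in>words ?K n. c x \<in> C1) \<Longrightarrow>
      (\<exists>T\<in>tmpl ?K m n. \<forall>w\<in>words ?K m. c (sub ?K T w) = c (sub ?K T (map ?\<mu> w)))"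
    by blast
  obtain ys where ys: "set ys = words ?K n" using finite_list[OF finite_words] by blast
  \<comment> \<open>A prefix is coloured by the values of \<open>c\<close> on all its extensions by
    tails in \<open>ys\<close>. Taking the number of such colours as the prefix length
    \<open>N\<close> leaves fewer colours than the \<open>N + 1\<close> prefixes
    \<open>s a\<close>.\<close>
  define C2 where "C2 = to_nat ` {l :: nat list. set l \<subseteq> C \<and> length l = length ys}"
  have fin2: "finite C2" unfolding C2_def by (rule finite_to_nat_lists[OF Suc.prems])
  define N where "N = card C2"
  show ?case
  proof (intro exI[of _ "N + n"] allI impI)
    fix c :: "nat list \<Rightarrow> nat" assume c: "\<forall>x\<in>words ?K (N + n). c x \<in> C"
    define s where "s a = replicate a (k - 1) @ replicate (N - a) k" for a
    define g where "g a = to_nat (map (\<lambda>y. c (s a @ y)) ys)" for a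
    have s: "s a \<in> words ?K N" if "a \<le> N" for a
      using that k by (auto simp: s_def words_def)
    have "g a \<in> C2" if "a \<le> N" for a
      using c append_words[OF s[OF that]] ys unfolding g_def C2_def
      by (intro imageI) auto
    hence "card (g ` {..N}) \<le> N" unfolding N_def
      by (intro card_mono fin2) auto
    hence "\<not> inj_on g {..N}" by (intro pigeonhole) simp
    then obtain a b where "a \<noteq> b" "a \<le> N" "b \<le> N" "g a = g b"
      by (auto simp: inj_on_def)
    then obtain a b where ab: "a < b" "b \<le> N" "g a = g b"
      by (metis nat_neq_iff)
    hence "map (\<lambda>y. c (s a @ y)) ys = map (\<lambda>y. c (s b @ y)) ys" by (simp add: g_def)
    hence gab: "\<And>y. y \<in> words ?K n \<Longrightarrow> c (s a @ y) = c (s b @ y)"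
      unfolding map_eq_conv ys by blast
    \<comment> \<open>The variable occupies the positions from \<open>a\<close> to \<open>b\<close>;
      its value \<open>k\<close> gives \<open>s a\<close> and its value \<open>k - 1\<close> gives
      \<open>s b\<close>.\<close>
    define S where "S = replicate a (k - 1) @ replicate (b - a) ?K @ replicate (N - b) k"
    have S: "S \<in> tmpl ?K 1 N" unfolding S_def by (rule tmpl_block) (use ab in auto)
    have Sa: "sub ?K S [k] = s a"
    proof -
      have "N - a = (b - a) + (N - b)" "k - 1 < ?K" using ab by auto
      thus ?thesis by (simp add: S_def sub_def s_def replicate_add)
    qed
    have Sb: "sub ?K S [k - 1] = s b"
    proof -
      have "b = a + (b - a)" using ab by simp
      hence "replicate b (k - 1) = replicate a (k - 1) @ replicate (b - a) (k - 1)"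
        by (metis replicate_add)
      moreover have "k - 1 < ?K" by simp
      ultimately show ?thesis by (simp add: S_def sub_def s_def)
    qed
    have S_merge: "c (sub ?K S [?\<mu> x] @ y) = c (sub ?K S [x] @ y)" if "y \<in> words ?K n" for x y
      using gab[OF that] Sa Sb by (simp add: merge_def)
    have S_words: "sub ?K S [x] \<in> words ?K N" if "x < ?K" for x
      by (rule sub_words[OF S]) (use that in \<open>simp add: words_def\<close>)
    define c1 where "c1 y = to_nat (map (\<lambda>x. c (sub ?K S [x] @ y)) [0..<?K])" for y
    have "c1 y \<in> C1" if y: "y \<in> words ?K n" for y
    proof -
      have "c (sub ?K S [x] @ y) \<in> C" if "x < ?K" for x
        using c append_words[OF S_words[OF that] y] by blast
      hence "set (map (\<lambda>x. c (sub ?K S [x] @ y)) [0..<?K]) \<subseteq> C"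
        unfolding set_map image_subset_iff by (simp del: upt_Suc)
      thus ?thesis unfolding c1_def C1_def by (intro imageI) simp
    qed
    then obtain T where T: "T \<in> tmpl ?K m n"
      and T': "\<And>w. w \<in> words ?K m \<Longrightarrow> c1 (sub ?K T w) = c1 (sub ?K T (map ?\<mu> w))"
      using n by blast
    show "\<exists>T\<in>tmpl ?K (Suc m) (N + n). \<forall>w\<in>words ?K (Suc m).
        c (sub ?K T w) = c (sub ?K T (map ?\<mu> w))"
    proof (intro bexI ballI)
      show "S @ shift_vars ?K 1 T \<in> tmpl ?K (Suc m) (N + n)"
        using tmpl_append_shift[OF S T] by simp
      fix w assume "w \<in> words ?K (Suc m)"
      then obtain x v where w: "w = x # v" "x < ?K" "v \<in> words ?K m"
        by (auto simp: words_def length_Suc_conv)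
      have v': "map ?\<mu> v \<in> words ?K m"
        using k map_merge_words[OF _ w(3), of "k - 1"] by (auto intro: words_mono)
      \<comment> \<open>The tail is merged first, by the choice of \<open>T\<close>, and then the
        leading letter, by the choice of \<open>S\<close>.\<close>
      have "c (sub ?K S [x] @ sub ?K T v) = c (sub ?K S [x] @ sub ?K T (map ?\<mu> v))"
      proof -
        have "map (\<lambda>x. c (sub ?K S [x] @ sub ?K T v)) [0..<?K] =
            map (\<lambda>x. c (sub ?K S [x] @ sub ?K T (map ?\<mu> v))) [0..<?K]"
          using T'[OF w(3)] by (simp only: c1_def to_nat_split inj_eq[OF inj_to_nat])
        thus ?thesis unfolding map_eq_conv using w(2) by (simp del: upt_Suc)
      qed
      also have "\<dots> = c (sub ?K S [?\<mu> x] @ sub ?K T (map ?\<mu> v))"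
        by (rule S_merge[symmetric]) (rule sub_words[OF T v'])
      finally show "c (sub ?K (S @ shift_vars ?K 1 T) w) = c (sub ?K (S @ shift_vars ?K 1 T) (map ?\<mu> w))"
        by (simp add: w(1) sub_Cons_shift[OF S] del: One_nat_def)
    qed
  qed
qed

text \<open>Induction on the alphabet: on a subspace where \<open>c\<close> does not distinguish the
  last two letters, the colouring is determined by words over one letter fewer. A monochromatic
  subspace for those, reread over the larger alphabet, stays monochromatic.\<close>

theorem hales_jewett:
  assumes "0 < k" and "finite C"
  shows "\<exists>n. \<forall>c::nat list \<Rightarrow> nat. (\<forall>x\<in>words k n. c x \<in> C) \<longrightarrow>
    (\<exists>T\<in>tmpl k m n. \<forall>w\<in>words k m. \<forall>w'\<in>words k m. c (sub k T w) = c (sub k T w'))"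
  using assms(1)
proof (induction k rule: nat_induct_non_zero)
  case 1
  have *: "w = replicate m 0" if "w \<in> words (Suc 0) m" for w
    using that by (intro replicate_eqI) (auto simp: words_def)
  show ?case
  proof (intro exI[of _ m] allI impI bexI[OF _ vars_tmpl] ballI)
    fix c :: "nat list \<Rightarrow> nat" and w w' assume "w \<in> words 1 m" "w' \<in> words 1 m"
    hence "w = w'" using *[of w] *[of w'] by simp
    thus "c (sub 1 [1..<1 + m] w) = c (sub 1 [1..<1 + m] w')" by simp
  qed
next
  case (Suc k)
  let ?K = "Suc k" and ?\<mu> = "merge k (k - 1)"
  from Suc.IH obtain M where M: "\<And>c::nat list \<Rightarrow> nat. (\<forall>x\<in>words k M. c x \<in> C) \<Longrightarrow>
    (\<exists>T\<in>tmpl k m M. \<forall>w\<in>words k m. \<forall>w'\<in>words k m. c (sub k T w) = c (sub k T w'))"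
    by blast
  from shelah_insensitive[OF Suc.hyps assms(2), of M] obtain n
    where n: "\<And>c::nat list \<Rightarrow> nat. (\<forall>x\<in>words ?K n. c x \<in> C) \<Longrightarrow>
      (\<exists>T\<in>tmpl ?K M n. \<forall>w\<in>words ?K M. c (sub ?K T w) = c (sub ?K T (map ?\<mu> w)))"
    by blast
  show ?case
  proof (intro exI[of _ n] allI impI)
    fix c :: "nat list \<Rightarrow> nat" assume c: "\<forall>x\<in>words ?K n. c x \<in> C"
    from n[OF this] obtain S where S: "S \<in> tmpl ?K M n"
      and S': "\<And>w. w \<in> words ?K M \<Longrightarrow> c (sub ?K S w) = c (sub ?K S (map ?\<mu> w))"
      by blast
    have "c (sub ?K S x) \<in> C" if "x \<in> words k M" for x
      using c sub_words[OF S words_mono[OF that]] by simp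
    then obtain T where T: "T \<in> tmpl k m M"
      and T': "\<And>w w'. w \<in> words k m \<Longrightarrow> w' \<in> words k m \<Longrightarrow> c (sub ?K S (sub k T w)) = c (sub ?K S (sub k T w'))"
      using M[of "\<lambda>x. c (sub ?K S x)"] by blast
    let ?U = "shift_vars k 1 T"
    have U: "?U \<in> tmpl ?K m M" by (rule lift_tmpl[OF T])
    \<comment> \<open>Insensitivity on \<open>S\<close>, used in both directions, replaces
      \<open>w\<close> by its merge, a word over \<open>k\<close> letters to which the choice of
      \<open>T\<close> applies.\<close>
    have key: "c (sub ?K (sub ?K S ?U) w) = c (sub ?K S (sub k T (map ?\<mu> w)))"
      if w: "w \<in> words ?K m" for w
    proof -
      have w': "map ?\<mu> w \<in> words k m" using w Suc.hyps by (intro map_merge_words) auto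
      have "sub ?K (sub ?K S ?U) w = sub ?K S (sub ?K ?U w)"
        using S U by (intro sub_sub) (auto simp: tmpl_def)
      also have "c \<dots> = c (sub ?K S (map ?\<mu> (sub ?K ?U w)))"
        by (rule S'[OF sub_words[OF U w]])
      also have "\<dots> = c (sub ?K S (map ?\<mu> (sub ?K ?U (map ?\<mu> w))))"
        using map_merge_sub[OF U length_words[OF w]] by simp
      also have "\<dots> = c (sub ?K S (sub ?K ?U (map ?\<mu> w)))"
        by (intro S'[symmetric] sub_words[OF U] words_mono[OF w']) simp
      finally show ?thesis unfolding sub_lift .
    qed
    show "\<exists>T\<in>tmpl ?K m n. \<forall>w\<in>words ?K m. \<forall>w'\<in>words ?K m. c (sub ?K T w) = c (sub ?K T w')"
    proof (intro bexI ballI)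
      show "sub ?K S ?U \<in> tmpl ?K m n" by (rule sub_tmpl[OF S U])
      fix w w' assume "w \<in> words ?K m" "w' \<in> words ?K m"
      thus "c (sub ?K (sub ?K S ?U) w) = c (sub ?K (sub ?K S ?U) w')"
        using Suc.hyps by (simp only: key) (intro T' map_merge_words; simp)
    qed
  qed
qed

section \<open>Subspaces all of whose points are good lines\<close>

lemma set_sub:
  assumes "T \<in> tmpl k m n" "length U = m"
  shows "set (sub k T U) \<subseteq> {s\<in>set T. s < k} \<union> set U"
proof
  fix s assume "s \<in> set (sub k T U)"
  then obtain t where t: "t \<in> set T" "s = (if t < k then t else U ! (t - k))"
    by (auto simp: sub_def)
  have "t - k < length U" if "\<not> t < k" using t that assms by (auto simp: tmpl_def)
  thus "s \<in> {s\<in>set T. s < k} \<union> set U" using t by auto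
qed

text \<open>A combinatorial line over the alphabet of size \<open>k\<close> is a word \<open>u k s\<close> over \<open>k + 1\<close> letters, with \<open>u\<close> the
  part before the first wildcard. Hales--Jewett on \<open>s\<close> makes a property of lines independent of \<open>s\<close>;
  wildcards among the constants of the subspace so found are merged into the variable of the
  distinguished \<open>k\<close>, so that the final subspace has no constant \<open>k\<close>.\<close>

lemma line_property_depends_on_prefix:
  assumes k: "0 < k"
  shows "\<exists>l. \<forall>good::nat list \<Rightarrow> bool. \<exists>T\<in>tmpl (Suc k) (j + m) l. k \<notin> set T \<and>
    (\<forall>i<j. \<forall>u\<in>words k i. \<forall>s\<in>words (Suc k) (j + m - Suc i). \<forall>s'\<in>words (Suc k) (j + m - Suc i).
       good (sub (Suc k) T (u @ k # s)) = good (sub (Suc k) T (u @ k # s')))"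
proof (induction j arbitrary: m)
  case 0
  have "k \<notin> set [Suc k..<Suc k + m]" by simp
  thus ?case using vars_tmpl[of "Suc k" m] unfolding add_0 by blast
next
  case (Suc j)
  let ?K = "Suc k"
  obtain us where us: "set us = words k j" using finite_list[OF finite_words] by blast
  \<comment> \<open>The colour of \<open>s\<close> records for every prefix \<open>u\<close> of
    length \<open>j\<close> whether the line \<open>u @ k # s\<close> is good.\<close>
  define C where "C = to_nat ` {l :: bool list. set l \<subseteq> UNIV \<and> length l = length us}"
  have "finite C" unfolding C_def by (intro finite_imageI finite_lists_length_eq) simp
  from hales_jewett[OF zero_less_Suc this, of k m] obtain n
    where n: "\<And>c::nat list \<Rightarrow> nat. (\<forall>x\<in>words ?K n. c x \<in> C) \<Longrightarrow>
      \<exists>T\<in>tmpl ?K m n. \<forall>w\<in>words ?K m. \<forall>w'\<in>words ?K m. c (sub ?K T w) = c (sub ?K T w')"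
    by blast
  \<comment> \<open>Of the \<open>Suc n\<close> additional variables, one is for the wildcard at
    position \<open>j\<close> and \<open>n\<close> are for the Hales-Jewett subspace.\<close>
  from Suc.IH[of "Suc n"] obtain l where l: "\<And>good::nat list \<Rightarrow> bool. \<exists>T\<in>tmpl ?K (j + Suc n) l.
      k \<notin> set T \<and> (\<forall>i<j. \<forall>u\<in>words k i. \<forall>s\<in>words ?K (j + Suc n - Suc i). \<forall>s'\<in>words ?K (j + Suc n - Suc i).
         good (sub ?K T (u @ k # s)) = good (sub ?K T (u @ k # s')))"
    by blast
  show ?case
  proof (intro exI[of _ l] allI)
    fix good :: "nat list \<Rightarrow> bool"
    from l[of good] obtain T where T: "T \<in> tmpl ?K (j + Suc n) l" "k \<notin> set T"
      and T_good: "\<And>i u s s'. i < j \<Longrightarrow> u \<in> words k i \<Longrightarrow> s \<in> words ?K (j + Suc n - Suc i) \<Longrightarrow>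
        s' \<in> words ?K (j + Suc n - Suc i) \<Longrightarrow> good (sub ?K T (u @ k # s)) = good (sub ?K T (u @ k # s'))"
      by blast
    define c where "c s = to_nat (map (\<lambda>u. good (sub ?K T (u @ k # s))) us)" for s
    have "\<forall>s\<in>words ?K n. c s \<in> C" by (auto simp: c_def C_def)
    from n[OF this] obtain U where U: "U \<in> tmpl ?K m n"
      and U': "\<And>w w'. w \<in> words ?K m \<Longrightarrow> w' \<in> words ?K m \<Longrightarrow> c (sub ?K U w) = c (sub ?K U w')"
      by blast
    have U_good: "good (sub ?K T (u @ k # sub ?K U w)) = good (sub ?K T (u @ k # sub ?K U w'))"
      if "u \<in> words k j" "w \<in> words ?K m" "w' \<in> words ?K m" for u w w'
    proof -
      have "map (\<lambda>u. good (sub ?K T (u @ k # sub ?K U w))) us = map (\<lambda>u. good (sub ?K T (u @ k # sub ?K U w'))) us"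
        using U'[OF that(2,3)] by (simp only: c_def inj_eq[OF inj_to_nat])
      thus ?thesis unfolding map_eq_conv us using that(1) by blast
    qed
    \<comment> \<open>Variable number \<open>j\<close> has the value \<open>k\<close> on words
      \<open>u @ k # s\<close> with \<open>u\<close> of length \<open>j\<close>, so replacing the
      constant \<open>k\<close> by it leaves the points in question unchanged. The variables of
      \<open>U\<close> move behind the first \<open>Suc j\<close>.\<close>
    define f where "f t = (if t = k then ?K + j else if t < k then t else t + Suc j)" for t
    define V where "V = [?K..<?K + Suc j] @ map f U"
    have lenU: "length U = n" using U by (simp add: tmpl_def)
    have setU: "set U \<subseteq> {..<?K + m}" "{?K..<?K + m} \<subseteq> set U" using U by (auto simp: tmpl_def)
    have V: "V \<in> tmpl ?K (Suc j + m) (Suc j + n)"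
    proof -
      have "f t < ?K + (Suc j + m)" if "t \<in> set U" for t
        using setU(1) that by (auto simp: f_def subset_iff)
      hence "set V \<subseteq> {..<?K + (Suc j + m)}" by (auto simp: V_def)
      moreover have in_V: "s \<in> set V" if "s \<in> {?K..<?K + (Suc j + m)}" for s
      proof (cases "s < ?K + Suc j")
        case False
        hence "s - Suc j \<in> {?K..<?K + m}" using that by auto
        hence "s - Suc j \<in> set U" using setU(2) by blast
        moreover have "f (s - Suc j) = s" using False by (auto simp: f_def)
        ultimately show ?thesis unfolding V_def by (auto intro!: image_eqI[where x = "s - Suc j"])
      qed (use that in \<open>auto simp: V_def\<close>)
      moreover have "{?K..<?K + (Suc j + m)} \<subseteq> set V" by (rule subsetI) (rule in_V)
      moreover have "length V = Suc j + n" using lenU by (simp add: V_def)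
      ultimately show ?thesis unfolding tmpl_def by simp
    qed
    have lenV: "length V = Suc j + n" using lenU by (simp add: V_def)
    have sub_V: "sub ?K V (v @ s) = v @ sub ?K (map f U) (v @ s)" if "length v = Suc j" for v s
      unfolding V_def sub_append using sub_vars_append1[OF that, of ?K s] by (simp only:)
    have sub_V_full: "sub ?K V (u @ k # s) = u @ k # sub ?K U s" if "length u = j" for u s
    proof -
      have "sub ?K (map f U) ((u @ [k]) @ s) = sub ?K U s"
        using that by (auto simp: sub_def f_def nth_append)
      thus ?thesis using sub_V[of "u @ [k]" s] that by simp
    qed
    show "\<exists>T\<in>tmpl ?K (Suc j + m) l. k \<notin> set T \<and>
      (\<forall>i<Suc j. \<forall>u\<in>words k i. \<forall>s\<in>words ?K (Suc j + m - Suc i). \<forall>s'\<in>words ?K (Suc j + m - Suc i).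
         good (sub ?K T (u @ k # s)) = good (sub ?K T (u @ k # s')))"
    proof (intro bexI conjI allI impI ballI)
      have T': "T \<in> tmpl ?K (Suc j + n) l" using T by simp
      show "sub ?K T V \<in> tmpl ?K (Suc j + m) l" by (rule sub_tmpl[OF T' V])
      have "k \<notin> set V" by (auto simp: V_def f_def split: if_splits)
      thus "k \<notin> set (sub ?K T V)" using T set_sub[OF T' lenV] by blast
      fix i u s s' assume i: "i < Suc j" and u: "u \<in> words k i"
        and s: "s \<in> words ?K (Suc j + m - Suc i)" "s' \<in> words ?K (Suc j + m - Suc i)"
      have eq: "sub ?K (sub ?K T V) x = sub ?K T (sub ?K V x)" for x
        by (rule sub_sub[OF T' lenV])
      show "good (sub ?K (sub ?K T V) (u @ k # s)) = good (sub ?K (sub ?K T V) (u @ k # s'))"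
      proof (cases "i = j")
        case True
        hence "length u = j" "u \<in> words k j" "s \<in> words ?K m" "s' \<in> words ?K m"
          using u s by (auto simp: words_def)
        thus ?thesis unfolding eq by (simp only: sub_V_full) (rule U_good)
      next
        case False
        hence ij: "i < j" using i by simp
        \<comment> \<open>\<open>V\<close> keeps the first \<open>Suc j\<close> letters in place,
          hence also everything up to a first wildcard at a position \<open>i < j\<close>; the
          property of \<open>T\<close> carries over.\<close>
        have *: "\<exists>r\<in>words ?K (j + Suc n - Suc i). sub ?K V (u @ k # s) = u @ k # r"
          if s: "s \<in> words ?K (Suc j + m - Suc i)" for s
        proof -
          have uks: "u @ k # s \<in> words ?K (Suc j + m)" using u s i by (auto simp: words_def)
          define v where "v = u @ k # take (j - i) s"
          have "length s \<ge> j - i" using s by (simp add: words_def)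
          hence v: "length v = Suc j" using ij u by (simp add: v_def words_def)
          have "u @ k # s = v @ drop (j - i) s" by (simp add: v_def)
          hence "sub ?K V (u @ k # s) = u @ k # (take (j - i) s @ sub ?K (map f U) (u @ k # s))"
            using sub_V[OF v, of "drop (j - i) s"] by (simp add: v_def)
          moreover have "sub ?K V (u @ k # s) \<in> words ?K (Suc j + n)" by (rule sub_words[OF V uks])
          ultimately show ?thesis using u by (auto simp: words_def)
        qed
        obtain r r' where "r \<in> words ?K (j + Suc n - Suc i)" "sub ?K V (u @ k # s) = u @ k # r"
          and "r' \<in> words ?K (j + Suc n - Suc i)" "sub ?K V (u @ k # s') = u @ k # r'"
          using *[OF s(1)] *[OF s(2)] by blast
        thus ?thesis unfolding eq using T_good[OF ij u, of r r'] by simp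
      qed
    qed
  qed
qed

text \<open>In a subspace where goodness depends only on the part before the first wildcard, one
  good line suffices: after its first wildcard the letters may be changed at will, and the last
  \<open>m\<close> of them become the free variables.\<close>

lemma good_subspace:
  assumes k: "0 < k"
  shows "\<exists>l. \<forall>good::nat list \<Rightarrow> bool.
    (\<forall>T\<in>tmpl (Suc k) m\<^sub>0 l. k \<notin> set T \<longrightarrow> (\<exists>x\<in>words (Suc k) m\<^sub>0. k \<in> set x \<and> good (sub (Suc k) T x))) \<longrightarrow>
    (\<exists>V\<in>tmpl (Suc k) m l. \<forall>w\<in>words (Suc k) m. k \<in> set (sub (Suc k) V w) \<and> good (sub (Suc k) V w))"
proof -
  let ?K = "Suc k"
  from line_property_depends_on_prefix[OF k, of m\<^sub>0 m] obtain l
    where l: "\<And>good::nat list \<Rightarrow> bool. \<exists>T\<in>tmpl ?K (m\<^sub>0 + m) l. k \<notin> set T \<and>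
      (\<forall>i<m\<^sub>0. \<forall>u\<in>words k i. \<forall>s\<in>words ?K (m\<^sub>0 + m - Suc i). \<forall>s'\<in>words ?K (m\<^sub>0 + m - Suc i).
         good (sub ?K T (u @ k # s)) = good (sub ?K T (u @ k # s')))" by blast
  show ?thesis
  proof (intro exI[of _ l] allI impI)
    fix good :: "nat list \<Rightarrow> bool"
    assume *: "\<forall>T\<in>tmpl ?K m\<^sub>0 l. k \<notin> set T \<longrightarrow> (\<exists>x\<in>words ?K m\<^sub>0. k \<in> set x \<and> good (sub ?K T x))"
    from l[of good] obtain T where T: "T \<in> tmpl ?K (m\<^sub>0 + m) l" "k \<notin> set T"
      and T_good: "\<And>i u s s'. i < m\<^sub>0 \<Longrightarrow> u \<in> words k i \<Longrightarrow> s \<in> words ?K (m\<^sub>0 + m - Suc i) \<Longrightarrow>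
        s' \<in> words ?K (m\<^sub>0 + m - Suc i) \<Longrightarrow> good (sub ?K T (u @ k # s)) = good (sub ?K T (u @ k # s'))"
      by blast
    \<comment> \<open>Freezing coordinates at \<open>0\<close> introduces no constant
      \<open>k\<close>, because \<open>0 < k\<close>.\<close>
    define Z where "Z = [?K..<?K + m\<^sub>0] @ replicate m 0"
    have Z: "Z \<in> tmpl ?K m\<^sub>0 (m\<^sub>0 + m)" unfolding Z_def
      by (intro tmpl_append_words vars_tmpl) (auto simp: words_def)
    have lenZ: "length Z = m\<^sub>0 + m" by (simp add: Z_def)
    have "k \<notin> set Z" using k by (auto simp: Z_def)
    hence "k \<notin> set (sub ?K T Z)" using set_sub[OF T(1) lenZ] T(2) by blast
    then obtain x where x: "x \<in> words ?K m\<^sub>0" "k \<in> set x" "good (sub ?K (sub ?K T Z) x)"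
      using * sub_tmpl[OF T(1) Z] by blast
    from split_list_first[OF x(2)] obtain u s where us: "x = u @ k # s" "k \<notin> set u" by blast
    define i where "i = length u"
    have i: "i < m\<^sub>0" using us x(1) by (simp add: words_def i_def)
    have "set u \<subseteq> {..<?K}" using x(1) us(1) by (auto simp: words_def)
    hence u: "u \<in> words k i" using us(2) by (fastforce simp: words_def i_def less_Suc_eq)
    have ls: "length s = m\<^sub>0 - Suc i" "set s \<subseteq> {..<?K}" using x(1) us(1) by (auto simp: words_def i_def)
    have "sub ?K Z x = x @ replicate m 0"
    proof -
      have "sub ?K (replicate m 0) x = replicate m 0" by (rule sub_const) auto
      thus ?thesis unfolding Z_def sub_append
        using sub_vars[of ?K x] length_words[OF x(1)] by (simp only:)
    qed
    hence g: "good (sub ?K T (u @ k # (s @ replicate m 0)))"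
      using x(3) sub_sub[OF T(1) lenZ] us(1) by simp
    define W where "W = (u @ k # replicate (m\<^sub>0 - Suc i) 0) @ [?K..<?K + m]"
    have W: "W \<in> tmpl ?K m (m\<^sub>0 + m)" unfolding W_def
      by (intro words_append_tmpl vars_tmpl) (use u i in \<open>auto simp: words_def\<close>)
    show "\<exists>V\<in>tmpl ?K m l. \<forall>w\<in>words ?K m. k \<in> set (sub ?K V w) \<and> good (sub ?K V w)"
    proof (intro bexI ballI)
      show V: "sub ?K T W \<in> tmpl ?K m l" by (rule sub_tmpl[OF T(1) W])
      fix w assume w: "w \<in> words ?K m"
      have "sub ?K W w = (u @ k # replicate (m\<^sub>0 - Suc i) 0) @ w"
      proof -
        have "sub ?K (u @ k # replicate (m\<^sub>0 - Suc i) 0) w = u @ k # replicate (m\<^sub>0 - Suc i) 0"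
          by (rule sub_const) (use u in \<open>auto simp: words_def\<close>)
        thus ?thesis unfolding W_def using sub_vars[of ?K w] length_words[OF w]
          by (simp only: sub_append)
      qed
      hence eq: "sub ?K (sub ?K T W) w = sub ?K T (u @ k # (replicate (m\<^sub>0 - Suc i) 0 @ w))"
        using sub_sub[OF T(1)] W by (simp add: tmpl_def)
      have "good (sub ?K T (u @ k # (replicate (m\<^sub>0 - Suc i) 0 @ w)))"
        using g by (subst (asm) T_good[OF i u]) (use ls i w in \<open>auto simp: words_def\<close>)
      moreover have "k \<in> set (sub ?K T (u @ k # (replicate (m\<^sub>0 - Suc i) 0 @ w)))"
      proof -
        have "?K + i \<in> set T" using T i by (auto simp: tmpl_def)
        thus ?thesis unfolding sub_def set_map
          by (intro image_eqI[where x = "?K + i"]) (auto simp: i_def)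
      qed
      ultimately show "k \<in> set (sub ?K (sub ?K T W) w) \<and> good (sub ?K (sub ?K T W) w)"
        unfolding eq by blast
    qed
  qed
qed

section \<open>The density statement and its multidimensional form\<close>

definition dhj :: "nat \<Rightarrow> bool" where
  "dhj k \<longleftrightarrow> (\<forall>\<delta>>0. \<exists>n\<^sub>0. \<forall>n\<ge>n\<^sub>0. \<forall>A\<subseteq>words k n. real (card A) \<ge> \<delta> * real k ^ n \<longrightarrow>
     (\<exists>T\<in>tmpl k 1 n. \<forall>i<k. sub k T [i] \<in> A))"

lemma card_sections:
  assumes "A \<subseteq> words k (n + m)"
  shows "real (card A) = (\<Sum>x\<in>words k n. real (card {y\<in>words k m. x @ y \<in> A}))"
proof -
  have "real (card A) = (\<Sum>x\<in>words k n. \<Sum>y\<in>words k m. of_bool (x @ y \<in> A))"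
    using assms by (simp only: real_card_eq_sum[OF finite_words assms] sum_words_append)
  also have "\<dots> = (\<Sum>x\<in>words k n. real (card {y\<in>words k m. x @ y \<in> A}))"
    by (rule sum.cong[OF refl]) (subst real_card_eq_sum[of "words k m"], auto intro: sum.cong)
  finally show ?thesis .
qed

lemma real_card_le_power: "A \<subseteq> words k n \<Longrightarrow> real (card A) \<le> real k ^ n"
  using card_mono[OF finite_words, of A k n] unfolding card_words
  by (metis of_nat_le_iff of_nat_power)

lemma section_density_le_1: "real (card {y\<in>words k m. P y}) / real k ^ m \<le> 1"
proof -
  have "real (card {y\<in>words k m. P y}) \<le> real k ^ m" by (rule real_card_le_power) auto
  moreover have "real k ^ m \<ge> 0" by simp
  ultimately show ?thesis unfolding divide_le_eq_1 by linarith
qed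

text \<open>Many prefixes have a dense section over the last \<open>q\<close> coordinates, which
  contains a line. By pigeonhole one line \<open>T\<close> works for a dense set of prefixes; an
  \<open>m\<close>-dimensional subspace of that set times \<open>T\<close> has dimension
  \<open>m + 1\<close>.\<close>

lemma multidim_dhj:
  assumes k: "0 < k" and dhj: "dhj k" and "0 < (\<delta>::real)"
  shows "\<exists>n\<^sub>0. \<forall>n\<ge>n\<^sub>0. \<forall>A\<subseteq>words k n. real (card A) \<ge> \<delta> * real k ^ n \<longrightarrow>
     (\<exists>T\<in>tmpl k m n. \<forall>w\<in>words k m. sub k T w \<in> A)"
  using assms(3)
proof (induction m arbitrary: \<delta>)
  case 0
  have "\<exists>T\<in>tmpl k 0 n. \<forall>w\<in>words k 0. sub k T w \<in> A"
    if A: "A \<subseteq> words k n" "real (card A) \<ge> \<delta> * real k ^ n" for n A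
  proof -
    have "\<delta> * real k ^ n > 0" using k 0 by simp
    hence "A \<noteq> {}" using A by auto
    then obtain x where "x \<in> A" by blast
    thus ?thesis using A(1) by (intro bexI[of _ x]) (auto simp: sub_words_const words_eq_tmpl[symmetric])
  qed
  thus ?case by blast
next
  case (Suc m)
  have "\<delta> / 2 > 0" using Suc.prems by simp
  from dhj[unfolded dhj_def, rule_format, OF this] obtain q
    where "\<forall>n\<ge>q. \<forall>A\<subseteq>words k n. real (card A) \<ge> \<delta> / 2 * real k ^ n \<longrightarrow>
      (\<exists>T\<in>tmpl k 1 n. \<forall>i<k. sub k T [i] \<in> A)" by (rule exE)
  note q = this[rule_format, OF order_refl]
  define Ts where "Ts = tmpl k 1 q"
  show ?case
  proof (cases "Ts = {}")
    \<comment> \<open>If there is no line of length \<open>q\<close>, the choice of \<open>q\<close>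
      denies density \<open>\<delta> / 2\<close> even to the full set. Hence no set of density
      \<open>\<delta>\<close> exists and the claim is vacuous.\<close>
    case True
    have "\<not> (A \<subseteq> words k n \<and> real (card A) \<ge> \<delta> * real k ^ n)" if "n \<ge> q" for n A
    proof
      assume A: "A \<subseteq> words k n \<and> real (card A) \<ge> \<delta> * real k ^ n"
      have "real (card A) \<le> real k ^ n" using A real_card_le_power by blast
      hence "\<delta> * real k ^ n \<le> 1 * real k ^ n" using A by linarith
      hence "\<delta> \<le> 1" using k by (subst (asm) mult_le_cancel_right) auto
      hence "\<delta> / 2 * real k ^ q \<le> 1 * real k ^ q" by (intro mult_right_mono) auto
      hence "real (card (words k q)) \<ge> \<delta> / 2 * real k ^ q" by simp
      thus False using q[OF subset_refl] True by (auto simp: Ts_def)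
    qed
    thus ?thesis by blast
  next
    case False
    define \<delta>' where "\<delta>' = \<delta> / (2 * card Ts)"
    have "card Ts > 0" using False unfolding Ts_def by (simp add: card_gt_0_iff)
    hence "\<delta>' > 0" using Suc.prems by (simp add: \<delta>'_def)
    from Suc.IH[OF this] obtain p\<^sub>0 where p0[rule_format]: "\<forall>p\<ge>p\<^sub>0. \<forall>A\<subseteq>words k p.
      real (card A) \<ge> \<delta>' * real k ^ p \<longrightarrow> (\<exists>T\<in>tmpl k m p. \<forall>w\<in>words k m. sub k T w \<in> A)"
      by (rule exE)
    have main: "\<exists>T\<in>tmpl k (Suc m) n. \<forall>w\<in>words k (Suc m). sub k T w \<in> A"
      if n: "n \<ge> p\<^sub>0 + q" and A: "A \<subseteq> words k n" "real (card A) \<ge> \<delta> * real k ^ n" for n A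
    proof -
      obtain p where p: "n = p + q" "p \<ge> p\<^sub>0" using n that(1) by (metis add.commute add_le_imp_le_right le_Suc_ex le_add2 order_trans)
      define f where "f x = real (card {y\<in>words k q. x @ y \<in> A}) / real k ^ q" for x
      define R where "R x T \<longleftrightarrow> (\<forall>i<k. x @ sub k T [i] \<in> A)" for x T
      have "(\<Sum>x\<in>words k p. f x) = real (card A) / real k ^ q"
        unfolding f_def using card_sections[of A k p q] A p by (simp add: sum_divide_distrib)
      also have "\<dots> \<ge> \<delta> * real k ^ n / real k ^ q" using A(2) by (intro divide_right_mono) auto
      also have "\<delta> * real k ^ n / real k ^ q = \<delta> * card (words k p)" using k by (simp add: p power_add)
      finally have avg: "(\<Sum>x\<in>words k p. f x) \<ge> \<delta> * card (words k p)" .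
      have ne: "words k p \<noteq> {}" using k card_words[of k p] by fastforce
      have finTs: "finite Ts" by (simp add: Ts_def)
      have f1: "f x \<le> 1" for x unfolding f_def by (rule section_density_le_1)
      have ex: "\<exists>T\<in>Ts. R x T" if "x \<in> words k p" "f x \<ge> \<delta> / 2" for x
      proof -
        have "real (card {y\<in>words k q. x @ y \<in> A}) \<ge> \<delta> / 2 * real k ^ q"
          using that k by (simp add: f_def field_simps)
        from q[OF _ this] show ?thesis by (auto simp: R_def Ts_def)
      qed
      obtain T where T: "T \<in> Ts" "card {x\<in>words k p. R x T} \<ge> \<delta> / (2 * card Ts) * card (words k p)"
        by (rule markov_pigeonhole[OF finite_words finTs ne Suc.prems f1 avg ex])
      have "\<exists>T'\<in>tmpl k m p. \<forall>w\<in>words k m. sub k T' w \<in> {x\<in>words k p. R x T}"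
        by (rule p0[OF p(2)]) (use T(2) in \<open>auto simp: \<delta>'_def\<close>)
      then obtain U where U: "U \<in> tmpl k m p" "\<And>w. w \<in> words k m \<Longrightarrow> R (sub k U w) T" by blast
      show ?thesis
      proof (intro bexI ballI)
        show "U @ shift_vars k m T \<in> tmpl k (Suc m) n"
          using tmpl_append_shift[OF U(1), of T 1 q] T(1) by (simp add: Ts_def p)
        fix w assume "w \<in> words k (Suc m)"
        then obtain u i where w: "w = u @ [i]" "u \<in> words k m" "i < k"
          by (cases w rule: rev_cases) (auto simp: words_def)
        show "sub k (U @ shift_vars k m T) w \<in> A"
          using U(2)[OF w(2)] w by (simp add: R_def sub_append_shift[OF U(1) length_words])
      qed
    qed
    show ?thesis by (intro exI[of _ "p\<^sub>0 + q"] allI impI) (rule main)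
  qed
qed

section \<open>Insensitive sets\<close>

text \<open>Splitting each coordinate according to whether its letter is \<open>k\<close> writes the uniform measure on
  words over \<open>k + 1\<close> letters as a mixture of uniform measures on copies of \<open>words k t\<close>. The last
  summand bounds the mass of the words with \<open>t < n\<^sub>0\<close> letters different from \<open>k\<close>, by an exponential moment.\<close>

lemma sum_words_Suc_le:
  fixes f :: "nat list \<Rightarrow> real"
  assumes f: "\<And>x. x \<in> words (Suc k) n \<Longrightarrow> f x \<le> 1" and \<beta>: "0 \<le> \<beta>"
    and hyp: "\<And>t T. t \<ge> n\<^sub>0 \<Longrightarrow> T \<in> tmpl (Suc k) t n \<Longrightarrow> (\<Sum>w\<in>words k t. f (sub (Suc k) T w)) \<le> \<beta> * real k ^ t"
    and "p + r = n" "Q \<in> tmpl (Suc k) t p"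
  shows "(\<Sum>w\<in>words k t. \<Sum>x\<in>words (Suc k) r. f (sub (Suc k) Q w @ x)) \<le>
    real k ^ t * (\<beta> * real (Suc k) ^ r + 2 ^ n\<^sub>0 / 2 ^ t * (1 + real k / 2) ^ r)"
  using assms(4,5)
proof (induction r arbitrary: p t Q)
  case 0
  show ?case
  proof (cases "t \<ge> n\<^sub>0")
    case True
    have "real k ^ t * (2 ^ n\<^sub>0 / 2 ^ t) \<ge> 0" by simp
    moreover have "(\<Sum>w\<in>words k t. f (sub (Suc k) Q w)) \<le> \<beta> * real k ^ t"
      by (rule hyp[OF True]) (use 0 in simp)
    ultimately have "(\<Sum>w\<in>words k t. f (sub (Suc k) Q w)) \<le> real k ^ t * (\<beta> + 2 ^ n\<^sub>0 / 2 ^ t)"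
      unfolding distrib_left by (simp only: mult.commute)
    thus ?thesis by simp
  next
    \<comment> \<open>With \<open>t < n\<^sub>0\<close> the trivial bound \<open>f \<le> 1\<close>
      is paid for by \<open>2 ^ n\<^sub>0 / 2 ^ t \<ge> 1\<close>.\<close>
    case False
    have "(\<Sum>w\<in>words k t. f (sub (Suc k) Q w)) \<le> (\<Sum>w\<in>words k t. 1)"
      by (intro sum_mono f) (use 0 sub_words[of Q "Suc k" t p] words_mono[of _ k t "Suc k"] in auto)
    also have "\<dots> = real k ^ t * 1" by simp
    also have "\<dots> \<le> real k ^ t * (\<beta> + 2 ^ n\<^sub>0 / 2 ^ t)"
      using False \<beta> by (intro mult_left_mono) (auto intro!: add_increasing simp: power_increasing)
    finally show ?thesis by simp
  qed
next
  case (Suc r)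
  let ?K = "Suc k"
  \<comment> \<open>The next coordinate is either the constant \<open>k\<close> or a new variable
    over the letters below \<open>k\<close>. The new variable contributes \<open>k\<close> choices
    at weight \<open>1 / 2\<close>, which yields the factor \<open>1 + k / 2\<close>.\<close>
  have Qk: "Q @ [k] \<in> tmpl ?K t (Suc p)" using Suc.prems by (auto simp: tmpl_def)
  have "{?K..<?K + Suc t} = {?K..<?K + t} \<union> {?K + t}" by auto
  hence Qv: "Q @ [?K + t] \<in> tmpl ?K (Suc t) (Suc p)" using Suc.prems by (auto simp: tmpl_def)
  have split: "(\<Sum>x\<in>words ?K (Suc r). g x) = (\<Sum>a<k. \<Sum>x\<in>words ?K r. g ([a] @ x)) + (\<Sum>x\<in>words ?K r. g ([k] @ x))" for g :: "nat list \<Rightarrow> real"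
    using sum_words_append[of g ?K 1 r] by (simp add: sum_words_1)
  have "(\<Sum>w\<in>words k t. \<Sum>x\<in>words ?K (Suc r). f (sub ?K Q w @ x)) =
      (\<Sum>w\<in>words k t. \<Sum>a<k. \<Sum>x\<in>words ?K r. f (sub ?K Q w @ ([a] @ x))) +
      (\<Sum>w\<in>words k t. \<Sum>x\<in>words ?K r. f (sub ?K Q w @ ([k] @ x)))"
    unfolding split by (simp only: sum.distrib)
  also have "(\<Sum>w\<in>words k t. \<Sum>x\<in>words ?K r. f (sub ?K Q w @ ([k] @ x))) =
      (\<Sum>w\<in>words k t. \<Sum>x\<in>words ?K r. f (sub ?K (Q @ [k]) w @ x))"
    by (simp add: sub_def)
  also have "\<dots> \<le> real k ^ t * (\<beta> * real ?K ^ r + 2 ^ n\<^sub>0 / 2 ^ t * (1 + real k / 2) ^ r)"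
    using Suc.prems by (intro Suc.IH[OF _ Qk]) simp
  also have "(\<Sum>w\<in>words k t. \<Sum>a<k. \<Sum>x\<in>words ?K r. f (sub ?K Q w @ ([a] @ x))) =
      (\<Sum>w\<in>words k (Suc t). \<Sum>x\<in>words ?K r. f (sub ?K (Q @ [?K + t]) w @ x))"
  proof -
    have "sub ?K (Q @ [?K + t]) (w @ [a]) = sub ?K Q w @ [a]" if "w \<in> words k t" for w a
      using Suc.prems(2) that by (auto simp: sub_def nth_append tmpl_def words_def)
    thus ?thesis using sum_words_append[of "\<lambda>w. \<Sum>x\<in>words ?K r. f (sub ?K (Q @ [?K + t]) w @ x)" k t 1]
      by (simp add: sum_words_1)
  qed
  also have "\<dots> \<le> real k ^ Suc t * (\<beta> * real ?K ^ r + 2 ^ n\<^sub>0 / 2 ^ Suc t * (1 + real k / 2) ^ r)"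
    using Suc.prems by (intro Suc.IH[OF _ Qv]) simp
  also have "real k ^ Suc t * (\<beta> * real ?K ^ r + 2 ^ n\<^sub>0 / 2 ^ Suc t * (1 + real k / 2) ^ r) +
      real k ^ t * (\<beta> * real ?K ^ r + 2 ^ n\<^sub>0 / 2 ^ t * (1 + real k / 2) ^ r) =
      real k ^ t * (\<beta> * real ?K ^ Suc r + 2 ^ n\<^sub>0 / 2 ^ t * (1 + real k / 2) ^ Suc r)"
    by (simp add: algebra_simps)
  finally show ?case by simp
qed

text \<open>Only the words of length \<open>n\<close> in \<open>D\<close> are constrained, so
  complements and preimages qualify without being cut down to that set of words.\<close>

definition insens :: "nat \<Rightarrow> nat \<Rightarrow> nat \<Rightarrow> nat list set \<Rightarrow> bool" where
  "insens k i n D \<longleftrightarrow> (\<forall>x\<in>words (Suc k) n. \<forall>x'\<in>words (Suc k) n.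
     map (merge k i) x = map (merge k i) x' \<longrightarrow> x \<in> D \<longrightarrow> x' \<in> D)"

lemma insensD:
  "insens k i n D \<Longrightarrow> x \<in> words (Suc k) n \<Longrightarrow> x' \<in> words (Suc k) n \<Longrightarrow>
   map (merge k i) x = map (merge k i) x' \<Longrightarrow> x \<in> D \<Longrightarrow> x' \<in> D"
  unfolding insens_def by blast

text \<open>Averaging gives a copy of \<open>words k t\<close>, with \<open>t\<close> large, on
  which \<open>D\<close> has density above \<open>\<gamma> / 2\<close>, and the theorem for
  \<open>k\<close> letters finds a subspace over \<open>k\<close> letters there. Insensitivity
  extends it to the letter \<open>k\<close>.\<close>

lemma insens_contains_subspace:
  assumes k: "0 < k" and dhj: "dhj k" and i: "i < k" and \<gamma>: "0 < (\<gamma>::real)"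
  shows "\<exists>n\<^sub>1. \<forall>n\<ge>n\<^sub>1. \<forall>D\<subseteq>words (Suc k) n. insens k i n D \<longrightarrow> real (card D) \<ge> \<gamma> * real (Suc k) ^ n \<longrightarrow>
     (\<exists>T\<in>tmpl (Suc k) m n. \<forall>w\<in>words (Suc k) m. sub (Suc k) T w \<in> D)"
proof -
  let ?K = "Suc k"
  have "\<gamma> / 2 > 0" using \<gamma> by simp
  from multidim_dhj[OF k dhj this, of m] obtain n\<^sub>0 where n0[rule_format]: "\<forall>n\<ge>n\<^sub>0. \<forall>A\<subseteq>words k n.
    real (card A) \<ge> \<gamma> / 2 * real k ^ n \<longrightarrow> (\<exists>T\<in>tmpl k m n. \<forall>w\<in>words k m. sub k T w \<in> A)"
    by (rule exE)
  \<comment> \<open>This ratio is below \<open>1\<close> because \<open>k > 0\<close>, so the mass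
    of words with few letters other than \<open>k\<close> eventually drops below
    \<open>\<gamma> / 2\<close>.\<close>
  define \<rho> where "\<rho> = (1 + real k / 2) / real ?K"
  have \<rho>: "0 \<le> \<rho>" "\<rho> < 1" using k by (auto simp: \<rho>_def field_simps)
  have "(\<lambda>n. 2 ^ n\<^sub>0 * \<rho> ^ n) \<longlonglongrightarrow> 2 ^ n\<^sub>0 * 0"
    by (intro tendsto_mult tendsto_const LIMSEQ_realpow_zero \<rho>)
  hence "eventually (\<lambda>n. 2 ^ n\<^sub>0 * \<rho> ^ n < \<gamma> / 2) sequentially"
    by (rule order_tendstoD(2)) (use \<gamma> in simp)
  then obtain n\<^sub>1 where n1: "\<And>n. n \<ge> n\<^sub>1 \<Longrightarrow> 2 ^ n\<^sub>0 * \<rho> ^ n < \<gamma> / 2" by (auto simp: eventually_sequentially)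
  have main: "\<exists>T\<in>tmpl ?K m n. \<forall>w\<in>words ?K m. sub ?K T w \<in> D"
    if n: "n \<ge> n\<^sub>1" and D: "D \<subseteq> words ?K n" "insens k i n D" "real (card D) \<ge> \<gamma> * real ?K ^ n" for n D
  proof -
    have "\<exists>t T. t \<ge> n\<^sub>0 \<and> T \<in> tmpl ?K t n \<and> (\<Sum>w\<in>words k t. of_bool (sub ?K T w \<in> D)) > \<gamma> / 2 * real k ^ t"
    proof (rule ccontr)
      assume "\<not> ?thesis"
      hence *: "(\<Sum>w\<in>words k t. of_bool (sub ?K T w \<in> D)) \<le> \<gamma> / 2 * real k ^ t"
        if "t \<ge> n\<^sub>0" "T \<in> tmpl ?K t n" for t T
        using that by (meson not_less)
      have "(\<Sum>w\<in>words k 0. \<Sum>x\<in>words ?K n. of_bool (sub ?K [] w @ x \<in> D)) \<le>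
        real k ^ 0 * (\<gamma> / 2 * real ?K ^ n + 2 ^ n\<^sub>0 / 2 ^ 0 * (1 + real k / 2) ^ n)"
      proof (rule sum_words_Suc_le[where p = 0 and n = n])
        show "[] \<in> tmpl ?K 0 0" by (simp add: tmpl_def)
      qed (use \<gamma> * in simp_all)
      hence "(\<Sum>x\<in>words ?K n. of_bool (x \<in> D)) \<le> \<gamma> / 2 * real ?K ^ n + 2 ^ n\<^sub>0 * (1 + real k / 2) ^ n"
        by (simp add: sub_def)
      moreover have "(\<Sum>x\<in>words ?K n. of_bool (x \<in> D)) = real (card D)"
        by (rule real_card_eq_sum[symmetric]) (use D in auto)
      moreover have "2 ^ n\<^sub>0 * (1 + real k / 2) ^ n = 2 ^ n\<^sub>0 * \<rho> ^ n * real ?K ^ n"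
        by (simp add: \<rho>_def power_divide)
      moreover have "2 ^ n\<^sub>0 * \<rho> ^ n * real ?K ^ n < \<gamma> / 2 * real ?K ^ n"
        using n1[OF n] by (intro mult_strict_right_mono) auto
      ultimately show False using D(3) by linarith
    qed
    then obtain t T where T: "t \<ge> n\<^sub>0" "T \<in> tmpl ?K t n"
      "(\<Sum>w\<in>words k t. of_bool (sub ?K T w \<in> D)) > \<gamma> / 2 * real k ^ t" by blast
    have "(\<Sum>w\<in>words k t. of_bool (sub ?K T w \<in> D)) = real (card {w\<in>words k t. sub ?K T w \<in> D})"
      by (subst real_card_eq_sum[of "words k t"]) (auto intro: sum.cong)
    hence "\<exists>U\<in>tmpl k m t. \<forall>w\<in>words k m. sub k U w \<in> {w\<in>words k t. sub ?K T w \<in> D}"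
      using T by (intro n0) auto
    then obtain U where U: "U \<in> tmpl k m t" "\<And>w. w \<in> words k m \<Longrightarrow> sub ?K T (sub k U w) \<in> D" by blast
    define V where "V = shift_vars k 1 U"
    have V: "V \<in> tmpl ?K m t" unfolding V_def by (rule lift_tmpl[OF U(1)])
    have TV: "sub ?K T V \<in> tmpl ?K m n" by (rule sub_tmpl[OF T(2) V])
    show ?thesis
    proof (intro bexI ballI)
      show "sub ?K T V \<in> tmpl ?K m n" by (rule TV)
      fix w assume w: "w \<in> words ?K m"
      have w': "map (merge k i) w \<in> words k m" by (rule map_merge_words[OF i w])
      have "sub ?K (sub ?K T V) (map (merge k i) w) = sub ?K T (sub k U (map (merge k i) w))"
      proof -
        have "length V = t" using V by (simp add: tmpl_def)
        thus ?thesis unfolding V_def by (simp only: sub_sub[OF T(2)] sub_lift)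
      qed
      hence "sub ?K (sub ?K T V) (map (merge k i) w) \<in> D" using U(2)[OF w'] by simp
      moreover have "map (merge k i) (sub ?K (sub ?K T V) (map (merge k i) w)) = map (merge k i) (sub ?K (sub ?K T V) w)"
        by (rule map_merge_sub[OF TV length_words[OF w]])
      ultimately show "sub ?K (sub ?K T V) w \<in> D"
        using insensD[OF D(2) sub_words[OF TV] sub_words[OF TV w]] w' words_mono[OF w', of ?K] by auto
    qed
  qed
  show ?thesis by (intro exI[of _ n\<^sub>1] allI impI) (rule main)
qed

lemma map_merge_sub_cong:
  assumes T: "T \<in> tmpl (Suc k) m n" and x: "x \<in> words (Suc k) m" "x' \<in> words (Suc k) m"
    and eq: "map (merge k i) x = map (merge k i) x'"
  shows "map (merge k i) (sub (Suc k) T x) = map (merge k i) (sub (Suc k) T x')"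
  using map_merge_sub[OF T length_words[OF x(1)], of i] map_merge_sub[OF T length_words[OF x(2)], of i] eq
  by simp

lemma insens_pullback:
  assumes T: "T \<in> tmpl (Suc k) m n" and D: "insens k i n D"
  shows "insens k i m {w. sub (Suc k) T w \<in> D}"
  unfolding insens_def
proof (intro ballI impI CollectI)
  fix x x' assume x: "x \<in> words (Suc k) m" "x' \<in> words (Suc k) m"
    and eq: "map (merge k i) x = map (merge k i) x'" and mem: "x \<in> {w. sub (Suc k) T w \<in> D}"
  have "map (merge k i) (sub (Suc k) T x) = map (merge k i) (sub (Suc k) T x')"
    by (rule map_merge_sub_cong[OF T x eq])
  thus "sub (Suc k) T x' \<in> D" using insensD[OF D sub_words[OF T x(1)] sub_words[OF T x(2)]] mem by blast
qed

lemma insens_Collect_append1: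
  assumes D: "insens k i (p + q) D" and z: "z \<in> words (Suc k) q"
  shows "insens k i p {y. y @ z \<in> D}"
  unfolding insens_def
proof (intro ballI impI CollectI)
  fix x x' assume "x \<in> words (Suc k) p" "x' \<in> words (Suc k) p"
    "map (merge k i) x = map (merge k i) x'" "x \<in> {y. y @ z \<in> D}"
  thus "x' @ z \<in> D" using insensD[OF D, of "x @ z" "x' @ z"] z by (simp add: append_words)
qed

lemma insens_Collect_append2:
  assumes D: "insens k i (p + q) D" and y: "y \<in> words (Suc k) p"
  shows "insens k i q {z. y @ z \<in> D}"
  unfolding insens_def
proof (intro ballI impI CollectI)
  fix x x' assume "x \<in> words (Suc k) q" "x' \<in> words (Suc k) q"
    "map (merge k i) x = map (merge k i) x'" "x \<in> {z. y @ z \<in> D}"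
  thus "y @ x' \<in> D" using insensD[OF D, of "y @ x" "y @ x'"] y by (simp add: append_words)
qed

lemma insens_Int: "insens k i n A \<Longrightarrow> insens k i n B \<Longrightarrow> insens k i n (A \<inter> B)"
  unfolding insens_def by blast

lemma insens_Compl: "insens k i n A \<Longrightarrow> insens k i n (- A)"
  unfolding insens_def by (metis ComplD ComplI)

lemma insens_Diff: "insens k i n A \<Longrightarrow> insens k i n B \<Longrightarrow> insens k i n (A - B)"
  unfolding Diff_eq by (intro insens_Int insens_Compl)

lemma insens_words: "insens k i n (words (Suc k) n)"
  unfolding insens_def by blast

lemma insens_INT: "(\<And>j. j \<in> J \<Longrightarrow> insens k i n (A j)) \<Longrightarrow> insens k i n (\<Inter>j\<in>J. A j)"
  unfolding insens_def by blast

lemma sum_filter_words: "(\<Sum>x\<in>words k n. if x \<in> D then f x else 0) = (\<Sum>x\<in>D \<inter> words k n. f x)"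
  by (subst sum.inter_restrict[symmetric]) (auto simp: Int_commute)

text \<open>Removing from an insensitive set \<open>D\<close> a union \<open>Y \<times> V\<close> of parallel subspaces leaves a set whose
  sections over the last coordinates are insensitive, so that the removal can be iterated until
  almost nothing is left.\<close>

lemma sum_insens_le_step:
  fixes f :: "nat list \<Rightarrow> real" and \<gamma> \<epsilon> c \<theta> :: real
  assumes Ts_def: "Ts = tmpl (Suc k) m q"
    and i: "i < k" and \<gamma>: "0 < \<gamma>" and \<epsilon>: "0 \<le> \<epsilon>" and c: "0 \<le> c" and \<theta>_le_1: "\<theta> \<le> 1"
    and \<theta>: "\<theta> \<le> \<gamma> / (2 * (real (card Ts) + 1)) / real (Suc k) ^ q"
    and subspace: "\<And>D. D \<subseteq> words (Suc k) q \<Longrightarrow> insens k i q D \<Longrightarrow> real (card D) \<ge> \<gamma> / 2 * real (Suc k) ^ q \<Longrightarrow>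
        \<exists>T\<in>Ts. \<forall>w\<in>words (Suc k) m. sub (Suc k) T w \<in> D"
    and IH: "\<And>(f :: nat list \<Rightarrow> real) D. (\<And>x. x \<in> words (Suc k) p \<Longrightarrow> f x \<le> 1) \<Longrightarrow>
        (\<And>T. T \<in> tmpl (Suc k) m p \<Longrightarrow> (\<Sum>w\<in>words (Suc k) m. f (sub (Suc k) T w)) \<le> \<epsilon> * real (Suc k) ^ m) \<Longrightarrow>
        D \<subseteq> words (Suc k) p \<Longrightarrow> insens k i p D \<Longrightarrow>
        (\<Sum>x\<in>D. f x) \<le> \<epsilon> * card D + \<gamma> * real (Suc k) ^ p + c * card D"
    and f: "\<And>x. x \<in> words (Suc k) (p + q) \<Longrightarrow> f x \<le> 1"
    and hyp: "\<And>T. T \<in> tmpl (Suc k) m (p + q) \<Longrightarrow> (\<Sum>w\<in>words (Suc k) m. f (sub (Suc k) T w)) \<le> \<epsilon> * real (Suc k) ^ m"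
    and D: "D \<subseteq> words (Suc k) (p + q)" "insens k i (p + q) D"
  shows "(\<Sum>x\<in>D. f x) \<le> \<epsilon> * card D + \<gamma> * real (Suc k) ^ (p + q) + c * (1 - \<theta>) * card D"
proof -
  let ?K = "Suc k"
  have finD: "finite D" by (rule finite_subset[OF D(1)]) simp
  have cardD: "real (card D) \<le> real ?K ^ (p + q)"
    by (rule real_card_le_power[OF D(1)])
  show ?thesis
  proof (cases "real (card D) \<le> \<gamma> * real ?K ^ (p + q)")
    \<comment> \<open>A set of density at most \<open>\<gamma>\<close> is absorbed by the error
      term.\<close>
    case small: True
    have "(\<Sum>x\<in>D. f x) \<le> (\<Sum>x\<in>D. 1)" by (intro sum_mono f) (use D in auto)
    hence "(\<Sum>x\<in>D. f x) \<le> \<gamma> * real ?K ^ (p + q)" using small by simp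
    moreover have "\<epsilon> * card D \<ge> 0" using \<epsilon> by simp
    moreover have "c * (1 - \<theta>) * card D \<ge> 0" using c \<theta>_le_1 by simp
    ultimately show ?thesis by linarith
  next
    case large: False
    define g where "g y = real (card {z\<in>words ?K q. y @ z \<in> D}) / real ?K ^ q" for y
    define R where "R y T \<longleftrightarrow> (\<forall>w\<in>words ?K m. y @ sub ?K T w \<in> D)" for y T
    have ne: "words ?K p \<noteq> {}" using card_words[of ?K p] by fastforce
    have finTs: "finite Ts" by (simp add: Ts_def)
    have g1: "g y \<le> 1" for y unfolding g_def by (rule section_density_le_1)
    have "(\<Sum>y\<in>words ?K p. g y) = real (card D) / real ?K ^ q"
      unfolding g_def using card_sections[OF D(1)] by (simp add: sum_divide_distrib)
    also have "\<dots> \<ge> \<gamma> * real ?K ^ (p + q) / real ?K ^ q" using large by (intro divide_right_mono) auto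
    also have "\<gamma> * real ?K ^ (p + q) / real ?K ^ q = \<gamma> * card (words ?K p)" by (simp add: power_add)
    finally have avg: "(\<Sum>y\<in>words ?K p. g y) \<ge> \<gamma> * card (words ?K p)" .
    have ex: "\<exists>T\<in>Ts. R y T" if y: "y \<in> words ?K p" "g y \<ge> \<gamma> / 2" for y
    proof -
      have "\<exists>T\<in>Ts. \<forall>w\<in>words ?K m. sub ?K T w \<in> {z\<in>words ?K q. y @ z \<in> D}"
      proof (rule subspace)
        show "real (card {z\<in>words ?K q. y @ z \<in> D}) \<ge> \<gamma> / 2 * real ?K ^ q"
          using y(2) by (simp add: g_def field_simps)
        show "insens k i q {z\<in>words ?K q. y @ z \<in> D}"
          using insens_Int[OF insens_words insens_Collect_append2[OF D(2) y(1)]] by (simp add: Collect_conj_eq)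
      qed auto
      thus ?thesis by (auto simp: R_def)
    qed
    obtain T where T: "T \<in> Ts" "card {y\<in>words ?K p. R y T} \<ge> \<gamma> / (2 * card Ts) * card (words ?K p)"
      by (rule markov_pigeonhole[OF finite_words finTs ne \<gamma> g1 avg ex])
    define Y where "Y = {y\<in>words ?K p. R y T}"
    have YD: "y @ sub ?K T w \<in> D" if "y \<in> Y" "w \<in> words ?K m" for y w
      using that by (simp add: Y_def R_def)
    have T': "T \<in> tmpl ?K m q" using T(1) by (simp add: Ts_def)
    define V where "V = sub ?K T ` words ?K m"
    have V: "V \<subseteq> words ?K q" unfolding V_def using sub_words[OF T'] by blast
    have sumV: "(\<Sum>z\<in>V. h z) = (\<Sum>w\<in>words ?K m. h (sub ?K T w))" for h :: "nat list \<Rightarrow> real"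
      unfolding V_def by (subst sum.reindex[OF inj_on_sub[OF T']]) simp
    have finY: "finite Y" and YW: "Y \<subseteq> words ?K p" by (auto simp: Y_def)
    \<comment> \<open>\<open>Y\<close> is an intersection of sections of \<open>D\<close>, so
      removing it keeps the remaining sections insensitive.\<close>
    have insY: "insens k i p Y"
    proof -
      have "Y = words ?K p \<inter> (\<Inter>w\<in>words ?K m. {y. y @ sub ?K T w \<in> D})" by (auto simp: Y_def R_def)
      thus ?thesis using insens_Collect_append1[OF D(2) sub_words[OF T']]
        by (simp only:) (intro insens_Int insens_words insens_INT)
    qed
    define Dz where "Dz z = {y\<in>words ?K p. y @ z \<in> D}" for z
    define Ez where "Ez z = (if z \<in> V then Dz z - Y else Dz z)" for z
    have finDz: "finite (Dz z)" for z by (simp add: Dz_def)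
    have insDz: "insens k i p (Dz z)" if "z \<in> words ?K q" for z
      using insens_Int[OF insens_words insens_Collect_append1[OF D(2) that]] by (simp add: Dz_def Collect_conj_eq)
    hence insEz: "insens k i p (Ez z)" if "z \<in> words ?K q" for z
      using that insY by (auto simp: Ez_def intro!: insens_Diff)
    have YDz: "Y \<subseteq> Dz z" if "z \<in> V" for z
      using that YD YW by (auto simp: V_def Dz_def)
    \<comment> \<open>This is the disjoint decomposition of \<open>D\<close> into the removed
      product \<open>Y \<times> V\<close> and the remaining sections \<open>Ez z\<close>.\<close>
    have split: "(\<Sum>x\<in>D. h x) = (\<Sum>z\<in>words ?K q. \<Sum>y\<in>Ez z. h (y @ z)) + (\<Sum>y\<in>Y. \<Sum>w\<in>words ?K m. h (y @ sub ?K T w))"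
      for h :: "nat list \<Rightarrow> real"
    proof -
      have "(\<Sum>x\<in>D. h x) = (\<Sum>x\<in>words ?K (p + q). if x \<in> D then h x else 0)"
        using D(1) by (simp add: sum_filter_words Int_absorb2)
      also have "\<dots> = (\<Sum>z\<in>words ?K q. \<Sum>y\<in>words ?K p. if y \<in> {y. y @ z \<in> D} then h (y @ z) else 0)"
        by (simp add: sum_words_append')
      also have "\<dots> = (\<Sum>z\<in>words ?K q. \<Sum>y\<in>Dz z. h (y @ z))"
        unfolding sum_filter_words by (intro sum.cong refl) (auto simp: Dz_def)
      also have "\<dots> = (\<Sum>z\<in>words ?K q. (\<Sum>y\<in>Ez z. h (y @ z)) + (if z \<in> V then \<Sum>y\<in>Y. h (y @ z) else 0))"
      proof (intro sum.cong refl)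
        fix z
        show "(\<Sum>y\<in>Dz z. h (y @ z)) = (\<Sum>y\<in>Ez z. h (y @ z)) + (if z \<in> V then \<Sum>y\<in>Y. h (y @ z) else 0)"
          using sum.subset_diff[OF YDz finDz, of z "\<lambda>y. h (y @ z)"] by (simp add: Ez_def)
      qed
      also have "\<dots> = (\<Sum>z\<in>words ?K q. \<Sum>y\<in>Ez z. h (y @ z)) + (\<Sum>z\<in>V. \<Sum>y\<in>Y. h (y @ z))"
        using V by (simp add: sum.distrib sum.If_cases Int_absorb1 Int_absorb2)
      also have "(\<Sum>z\<in>V. \<Sum>y\<in>Y. h (y @ z)) = (\<Sum>y\<in>Y. \<Sum>w\<in>words ?K m. h (y @ sub ?K T w))"
        by (subst sum.swap) (simp add: sumV)
      finally show ?thesis .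
    qed
    have bound_Y: "(\<Sum>y\<in>Y. \<Sum>w\<in>words ?K m. f (y @ sub ?K T w)) \<le> card Y * (\<epsilon> * real ?K ^ m)"
    proof -
      have "(\<Sum>w\<in>words ?K m. f (y @ sub ?K T w)) \<le> \<epsilon> * real ?K ^ m" if "y \<in> Y" for y
      proof -
        have y: "y \<in> words ?K p" using that YW by blast
        have "sub ?K (y @ T) w = y @ sub ?K T w" for w
          by (simp add: sub_append sub_words_const[OF y])
        thus ?thesis using hyp[OF words_append_tmpl[OF T' y]] by simp
      qed
      from sum_mono[of Y, OF this] show ?thesis by simp
    qed
    have cE: "(\<Sum>z\<in>words ?K q. real (card (Ez z))) = card D - card Y * real ?K ^ m"
      using split[of "\<lambda>_. 1"] by simp
    have bound_E: "(\<Sum>y\<in>Ez z. f (y @ z)) \<le> \<epsilon> * card (Ez z) + \<gamma> * real ?K ^ p + c * card (Ez z)"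
      if z: "z \<in> words ?K q" for z
    proof (rule IH)
      show "f (y @ z) \<le> 1" if "y \<in> words ?K p" for y using that z by (intro f append_words)
      show "Ez z \<subseteq> words ?K p" by (auto simp: Ez_def Dz_def)
      show "insens k i p (Ez z)" by (rule insEz[OF z])
      fix S assume S: "S \<in> tmpl ?K m p"
      have "sub ?K (S @ z) w = sub ?K S w @ z" for w by (simp add: sub_append sub_words_const[OF z])
      thus "(\<Sum>w\<in>words ?K m. f (sub ?K S w @ z)) \<le> \<epsilon> * real ?K ^ m"
        using hyp[OF tmpl_append_words[OF S z]] by simp
    qed
    have "(\<Sum>z\<in>words ?K q. \<Sum>y\<in>Ez z. f (y @ z)) \<le>
        (\<Sum>z\<in>words ?K q. \<epsilon> * card (Ez z) + \<gamma> * real ?K ^ p + c * card (Ez z))"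
      by (intro sum_mono bound_E)
    also have "\<dots> = \<epsilon> * (\<Sum>z\<in>words ?K q. real (card (Ez z))) + \<gamma> * real ?K ^ (p + q) +
        c * (\<Sum>z\<in>words ?K q. real (card (Ez z)))"
      by (simp add: sum.distrib sum_distrib_left power_add)
    finally have main: "(\<Sum>x\<in>D. f x) \<le> \<epsilon> * card D + \<gamma> * real ?K ^ (p + q) + c * (card D - card Y * real ?K ^ m)"
      unfolding cE split[of f] using bound_Y by (simp add: algebra_simps)
    \<comment> \<open>The removed product has at least the proportion \<open>\<theta>\<close> of
      \<open>D\<close>, which improves the constant \<open>c\<close> to
      \<open>c * (1 - \<theta>)\<close>.\<close>
    have "\<theta> * card D \<le> card Y * real ?K ^ m"
    proof (cases "\<theta> \<le> 0")
      case True
      hence "\<theta> * card D \<le> 0" by (intro mult_nonpos_nonneg) auto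
      also have "0 \<le> card Y * real ?K ^ m" by simp
      finally show ?thesis .
    next
      case False
      have cT: "card Ts > 0" using T(1) finTs by (auto simp: card_gt_0_iff)
      have "\<theta> * card D \<le> \<theta> * real ?K ^ (p + q)" using cardD False by (intro mult_left_mono) auto
      also have "\<dots> \<le> (\<gamma> / (2 * (real (card Ts) + 1)) / real ?K ^ q) * real ?K ^ (p + q)"
        using \<theta> by (intro mult_right_mono) auto
      also have "\<dots> = \<gamma> / (2 * (real (card Ts) + 1)) * real ?K ^ p" by (simp add: power_add)
      also have "\<dots> \<le> \<gamma> / (2 * card Ts) * real ?K ^ p"
        using cT \<gamma> by (intro mult_right_mono divide_left_mono) auto
      also have "\<dots> \<le> card Y" using T(2) by (simp add: Y_def)
      also have "\<dots> \<le> card Y * real ?K ^ m" using mult_left_mono[of 1 "real ?K ^ m" "card Y"] by (simp add: one_le_power)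
      finally show ?thesis .
    qed
    hence "c * (card D - card Y * real ?K ^ m) \<le> c * (card D - \<theta> * card D)"
      using c by (intro mult_left_mono) auto
    thus ?thesis using main by (simp add: algebra_simps)
  qed
qed

text \<open>Each block of \<open>q\<close> coordinates allows one removal of parallel subspaces, on
  which \<open>f\<close> has mean at most \<open>\<epsilon>\<close>. The removals stop when the
  leftover factor is below \<open>\<gamma> / 2\<close>; the other half of \<open>\<gamma>\<close>
  covers sets already too small to contain a subspace.\<close>

lemma sum_insens_le:
  fixes \<gamma> :: real
  assumes k: "0 < k" and dhj: "dhj k" and i: "i < k" and \<gamma>: "0 < \<gamma>"
  shows "\<exists>n\<^sub>0. \<forall>n\<ge>n\<^sub>0. \<forall>(f :: nat list \<Rightarrow> real) \<epsilon> D. 0 \<le> \<epsilon> \<longrightarrow> (\<forall>x\<in>words (Suc k) n. f x \<le> 1) \<longrightarrow>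
      (\<forall>T\<in>tmpl (Suc k) m n. (\<Sum>w\<in>words (Suc k) m. f (sub (Suc k) T w)) \<le> \<epsilon> * real (Suc k) ^ m) \<longrightarrow>
      D \<subseteq> words (Suc k) n \<longrightarrow> insens k i n D \<longrightarrow> (\<Sum>x\<in>D. f x) \<le> \<epsilon> * card D + \<gamma> * real (Suc k) ^ n"
proof -
  let ?K = "Suc k"
  define \<gamma>' where "\<gamma>' = \<gamma> / 2"
  have \<gamma>': "\<gamma>' > 0" "\<gamma>' / 2 > 0" using \<gamma> by (auto simp: \<gamma>'_def)
  from insens_contains_subspace[OF k dhj i \<gamma>'(2), of m] obtain q
    where "\<forall>n\<ge>q. \<forall>D\<subseteq>words ?K n. insens k i n D \<longrightarrow> real (card D) \<ge> \<gamma>' / 2 * real ?K ^ n \<longrightarrow>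
     (\<exists>T\<in>tmpl ?K m n. \<forall>w\<in>words ?K m. sub ?K T w \<in> D)" by (rule exE)
  note q = this[rule_format, OF order_refl]
  define \<theta> where "\<theta> = min (1 / 2) (\<gamma>' / (2 * (real (card (tmpl ?K m q)) + 1)) / real ?K ^ q)"
  have \<theta>: "0 < \<theta>" "\<theta> \<le> 1 / 2" "\<theta> \<le> \<gamma>' / (2 * (real (card (tmpl ?K m q)) + 1)) / real ?K ^ q"
    unfolding \<theta>_def by (simp add: \<gamma>'(1) add_nonneg_pos, rule min.cobounded1, rule min.cobounded2)
  \<comment> \<open>The error \<open>\<gamma>'\<close> does not accumulate with \<open>j\<close>:
    the errors over the sections add up to a single error for the whole space.\<close>
  have claim: "(\<Sum>x\<in>D. f x) \<le> \<epsilon> * card D + \<gamma>' * real ?K ^ n + (1 - \<theta>) ^ j * card D"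
    if "j * q \<le> n" "0 \<le> \<epsilon>" "\<And>x. x \<in> words ?K n \<Longrightarrow> f x \<le> 1"
      "\<And>T. T \<in> tmpl ?K m n \<Longrightarrow> (\<Sum>w\<in>words ?K m. f (sub ?K T w)) \<le> \<epsilon> * real ?K ^ m"
      "D \<subseteq> words ?K n" "insens k i n D" for j n \<epsilon> D and f :: "nat list \<Rightarrow> real"
    using that
  proof (induction j arbitrary: n f D)
    case 0
    have "(\<Sum>x\<in>D. f x) \<le> (\<Sum>x\<in>D. 1)" by (intro sum_mono) (use 0 in auto)
    moreover have "\<epsilon> * card D \<ge> 0" "\<gamma>' * real ?K ^ n \<ge> 0" using 0 \<gamma>' by auto
    ultimately show ?case by simp
  next
    case (Suc j)
    obtain p where p: "n = p + q" "j * q \<le> p"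
      using Suc.prems(1) by (intro that[of "n - q"]) auto
    have "(\<Sum>x\<in>D. f x) \<le> \<epsilon> * card D + \<gamma>' * real ?K ^ (p + q) + (1 - \<theta>) ^ j * (1 - \<theta>) * card D"
    proof (rule sum_insens_le_step[OF refl i \<gamma>'(1) Suc.prems(2) _ _ \<theta>(3) q])
      show "D \<subseteq> words ?K (p + q)" "insens k i (p + q) D" using Suc.prems p by auto
      show "(\<Sum>x\<in>D. f x) \<le> \<epsilon> * card D + \<gamma>' * real ?K ^ p + (1 - \<theta>) ^ j * card D"
        if "\<And>x. x \<in> words ?K p \<Longrightarrow> f x \<le> 1"
          "\<And>T. T \<in> tmpl ?K m p \<Longrightarrow> (\<Sum>w\<in>words ?K m. f (sub ?K T w)) \<le> \<epsilon> * real ?K ^ m"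
          "D \<subseteq> words ?K p" "insens k i p D" for f :: "nat list \<Rightarrow> real" and D
        by (rule Suc.IH[OF p(2) Suc.prems(2) that])
    qed (use \<theta> Suc.prems p in auto)
    thus ?case by (simp add: p mult.commute)
  qed
  have "(\<lambda>j. (1 - \<theta>) ^ j) \<longlonglongrightarrow> 0" using \<theta> by (intro LIMSEQ_realpow_zero) auto
  hence "eventually (\<lambda>j. (1 - \<theta>) ^ j < \<gamma>') sequentially" by (rule order_tendstoD(2)) (rule \<gamma>')
  then obtain j where j: "(1 - \<theta>) ^ j < \<gamma>'" by (auto simp: eventually_sequentially)
  show ?thesis
  proof (intro exI[of _ "j * q"] allI impI)
    fix n and f :: "nat list \<Rightarrow> real" and \<epsilon> D
    assume *: "j * q \<le> n" "0 \<le> \<epsilon>" "\<forall>x\<in>words ?K n. f x \<le> 1"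
      "\<forall>T\<in>tmpl ?K m n. (\<Sum>w\<in>words ?K m. f (sub ?K T w)) \<le> \<epsilon> * real ?K ^ m"
      "D \<subseteq> words ?K n" "insens k i n D"
    have "(\<Sum>x\<in>D. f x) \<le> \<epsilon> * card D + \<gamma>' * real ?K ^ n + (1 - \<theta>) ^ j * card D"
      by (rule claim) (use * in auto)
    moreover have "(1 - \<theta>) ^ j * card D \<le> \<gamma>' * real ?K ^ n"
      using j \<gamma>' real_card_le_power[OF *(5)] by (intro mult_mono) auto
    ultimately show "(\<Sum>x\<in>D. f x) \<le> \<epsilon> * card D + \<gamma> * real ?K ^ n" by (simp add: \<gamma>'_def)
  qed
qed

text \<open>Induction on the number of sets. Restricting \<open>f\<close> to the first
  \<open>s\<close> sets gives a function whose means on \<open>m'\<close>-dimensional subspaces are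
  small by the induction hypothesis inside these subspaces; the single-set bound then treats the
  last set.\<close>

lemma sum_insens_Inter_le:
  fixes \<gamma> :: real
  assumes k: "0 < k" and dhj: "dhj k" and "s \<le> k" and "0 < \<gamma>"
  shows "\<exists>n\<^sub>0. \<forall>n\<ge>n\<^sub>0. \<forall>(f :: nat list \<Rightarrow> real) \<epsilon> D. 0 \<le> \<epsilon> \<longrightarrow> (\<forall>x\<in>words (Suc k) n. f x \<le> 1) \<longrightarrow>
      (\<forall>T\<in>tmpl (Suc k) m n. (\<Sum>w\<in>words (Suc k) m. f (sub (Suc k) T w)) \<le> \<epsilon> * real (Suc k) ^ m) \<longrightarrow>
      (\<forall>i<s. insens k i n (D i)) \<longrightarrow>
      (\<Sum>x\<in>(\<Inter>i<s. D i) \<inter> words (Suc k) n. f x) \<le> (\<epsilon> + \<gamma>) * real (Suc k) ^ n"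
  using assms(3,4)
proof (induction s arbitrary: \<gamma>)
  case 0
  let ?K = "Suc k"
  \<comment> \<open>An empty intersection is the full set of words, which is insensitive for the
    letter \<open>0\<close>.\<close>
  from sum_insens_le[OF k dhj k 0(2), of m] obtain n\<^sub>0 where n0[rule_format]:
    "\<forall>n\<ge>n\<^sub>0. \<forall>(f :: nat list \<Rightarrow> real) \<epsilon> D. 0 \<le> \<epsilon> \<longrightarrow> (\<forall>x\<in>words ?K n. f x \<le> 1) \<longrightarrow>
      (\<forall>T\<in>tmpl ?K m n. (\<Sum>w\<in>words ?K m. f (sub ?K T w)) \<le> \<epsilon> * real ?K ^ m) \<longrightarrow>
      D \<subseteq> words ?K n \<longrightarrow> insens k 0 n D \<longrightarrow> (\<Sum>x\<in>D. f x) \<le> \<epsilon> * card D + \<gamma> * real ?K ^ n"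
    by (rule exE)
  show ?case
  proof (intro exI[of _ n\<^sub>0] allI impI)
    fix n and f :: "nat list \<Rightarrow> real" and \<epsilon> :: real and D :: "nat \<Rightarrow> nat list set"
    assume *: "n\<^sub>0 \<le> n" "0 \<le> \<epsilon>" "\<forall>x\<in>words ?K n. f x \<le> 1"
      "\<forall>T\<in>tmpl ?K m n. (\<Sum>w\<in>words ?K m. f (sub ?K T w)) \<le> \<epsilon> * real ?K ^ m"
    have "(\<Sum>x\<in>words ?K n. f x) \<le> \<epsilon> * card (words ?K n) + \<gamma> * real ?K ^ n"
      by (rule n0) (use * insens_words in auto)
    thus "(\<Sum>x\<in>(\<Inter>i<0. D i) \<inter> words ?K n. f x) \<le> (\<epsilon> + \<gamma>) * real ?K ^ n"
      by (simp add: distrib_right)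
  qed
next
  case (Suc s)
  let ?K = "Suc k"
  have \<gamma>2: "\<gamma> / 2 > 0" and sk: "s \<le> k" "s < k" using Suc.prems by auto
  from Suc.IH[OF sk(1) \<gamma>2] obtain m' where m': 
    "\<forall>n\<ge>m'. \<forall>(f :: nat list \<Rightarrow> real) \<epsilon> D. 0 \<le> \<epsilon> \<longrightarrow> (\<forall>x\<in>words ?K n. f x \<le> 1) \<longrightarrow>
      (\<forall>T\<in>tmpl ?K m n. (\<Sum>w\<in>words ?K m. f (sub ?K T w)) \<le> \<epsilon> * real ?K ^ m) \<longrightarrow>
      (\<forall>i<s. insens k i n (D i)) \<longrightarrow>
      (\<Sum>x\<in>(\<Inter>i<s. D i) \<inter> words ?K n. f x) \<le> (\<epsilon> + \<gamma> / 2) * real ?K ^ n"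
    by (rule exE)
  note m' = m'[rule_format, OF order_refl]
  from sum_insens_le[OF k dhj sk(2) \<gamma>2, of m'] obtain n\<^sub>0 where n0[rule_format]:
    "\<forall>n\<ge>n\<^sub>0. \<forall>(f :: nat list \<Rightarrow> real) \<epsilon> D. 0 \<le> \<epsilon> \<longrightarrow> (\<forall>x\<in>words ?K n. f x \<le> 1) \<longrightarrow>
      (\<forall>T\<in>tmpl ?K m' n. (\<Sum>w\<in>words ?K m'. f (sub ?K T w)) \<le> \<epsilon> * real ?K ^ m') \<longrightarrow>
      D \<subseteq> words ?K n \<longrightarrow> insens k s n D \<longrightarrow> (\<Sum>x\<in>D. f x) \<le> \<epsilon> * card D + \<gamma> / 2 * real ?K ^ n"
    by (rule exE)
  show ?case
  proof (intro exI[of _ n\<^sub>0] allI impI)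
    fix n and f :: "nat list \<Rightarrow> real" and \<epsilon> :: real and D :: "nat \<Rightarrow> nat list set"
    assume *: "n\<^sub>0 \<le> n" "0 \<le> \<epsilon>" "\<forall>x\<in>words ?K n. f x \<le> 1"
      "\<forall>T\<in>tmpl ?K m n. (\<Sum>w\<in>words ?K m. f (sub ?K T w)) \<le> \<epsilon> * real ?K ^ m"
      "\<forall>i<Suc s. insens k i n (D i)"
    define E where "E = (\<Inter>i<s. D i)"
    define g where "g x = (if x \<in> E then f x else 0)" for x
    have g_hyp: "(\<Sum>w\<in>words ?K m'. g (sub ?K T w)) \<le> (\<epsilon> + \<gamma> / 2) * real ?K ^ m'"
      if T: "T \<in> tmpl ?K m' n" for T
    proof -
      have "(\<Sum>w\<in>words ?K m'. g (sub ?K T w)) =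
          (\<Sum>w\<in>words ?K m'. if w \<in> (\<Inter>i<s. {w. sub ?K T w \<in> D i}) then f (sub ?K T w) else 0)"
        by (intro sum.cong refl) (auto simp: g_def E_def)
      also have "\<dots> = (\<Sum>w\<in>(\<Inter>i<s. {w. sub ?K T w \<in> D i}) \<inter> words ?K m'. f (sub ?K T w))"
        by (rule sum_filter_words)
      also have "\<dots> \<le> (\<epsilon> + \<gamma> / 2) * real ?K ^ m'"
      proof (rule m')
        show "0 \<le> \<epsilon>" by fact
        show "f (sub ?K T w) \<le> 1" if "w \<in> words ?K m'" for w using sub_words[OF T that] * by blast
        show "insens k i m' {w. sub ?K T w \<in> D i}" if "i < s" for i
          using that *(5) by (intro insens_pullback[OF T]) auto
        fix S assume S: "S \<in> tmpl ?K m m'"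
        hence "sub ?K T (sub ?K S w) = sub ?K (sub ?K T S) w" for w
          by (subst sub_sub[OF T]) (auto simp: tmpl_def)
        thus "(\<Sum>w\<in>words ?K m. f (sub ?K T (sub ?K S w))) \<le> \<epsilon> * real ?K ^ m"
          using *(4) sub_tmpl[OF T S] by simp
      qed
      finally show ?thesis .
    qed
    have "(\<Sum>x\<in>(\<Inter>i<Suc s. D i) \<inter> words ?K n. f x) = (\<Sum>x\<in>D s \<inter> words ?K n. g x)"
    proof -
      have eq: "(\<Inter>i<Suc s. D i) \<inter> words ?K n = (D s \<inter> words ?K n) \<inter> E" by (auto simp: E_def less_Suc_eq)
      show ?thesis unfolding eq g_def by (rule sum.inter_restrict) simp
    qed
    also have "\<dots> \<le> (\<epsilon> + \<gamma> / 2) * card (D s \<inter> words ?K n) + \<gamma> / 2 * real ?K ^ n"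
    proof (rule n0)
      show "0 \<le> \<epsilon> + \<gamma> / 2" using *(2) \<gamma>2 by simp
      show "g x \<le> 1" if "x \<in> words ?K n" for x using that *(3) by (simp add: g_def)
      show "insens k s n (D s \<inter> words ?K n)" using *(5) by (intro insens_Int insens_words) auto
    qed (use *(1) g_hyp in auto)
    also have "\<dots> \<le> (\<epsilon> + \<gamma> / 2) * real ?K ^ n + \<gamma> / 2 * real ?K ^ n"
    proof -
      have "real (card (D s \<inter> words ?K n)) \<le> real ?K ^ n" by (rule real_card_le_power) simp
      thus ?thesis using *(2) \<gamma>2 by (intro add_right_mono mult_left_mono) auto
    qed
    finally show "(\<Sum>x\<in>(\<Inter>i<Suc s. D i) \<inter> words ?K n. f x) \<le> (\<epsilon> + \<gamma>) * real ?K ^ n"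
      by (simp add: algebra_simps)
  qed
qed

section \<open>The density Hales--Jewett theorem\<close>

definition line_free :: "nat \<Rightarrow> nat \<Rightarrow> nat list set \<Rightarrow> bool" where
  "line_free k n A \<longleftrightarrow> A \<subseteq> words k n \<and> \<not> (\<exists>T\<in>tmpl k 1 n. \<forall>i<k. sub k T [i] \<in> A)"

lemma line_free_pullback:
  assumes A: "line_free k n A" and T: "T \<in> tmpl k m n"
  shows "line_free k m {w\<in>words k m. sub k T w \<in> A}"
  unfolding line_free_def
proof (intro conjI notI)
  assume "\<exists>S\<in>tmpl k 1 m. \<forall>i<k. sub k S [i] \<in> {w\<in>words k m. sub k T w \<in> A}"
  then obtain S where S: "S \<in> tmpl k 1 m" "\<And>i. i < k \<Longrightarrow> sub k T (sub k S [i]) \<in> A" by blast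
  have "length S = m" using S(1) by (simp add: tmpl_def)
  hence "\<forall>i<k. sub k (sub k T S) [i] \<in> A" using S(2) by (simp add: sub_sub[OF T])
  thus False using A sub_tmpl[OF T S(1)] unfolding line_free_def by blast
qed auto

lemma line_free_section:
  assumes A: "line_free k (p + q) A" and x: "x \<in> words k p"
  shows "line_free k q {y\<in>words k q. x @ y \<in> A}"
proof -
  have T: "x @ [k..<k + q] \<in> tmpl k q (p + q)" by (intro words_append_tmpl vars_tmpl x)
  have "sub k (x @ [k..<k + q]) y = x @ y" if "y \<in> words k q" for y
    using sub_vars[of k y] length_words[OF that] by (simp add: sub_append sub_words_const[OF x])
  hence "{y\<in>words k q. sub k (x @ [k..<k + q]) y \<in> A} = {y\<in>words k q. x @ y \<in> A}" by auto
  thus ?thesis using line_free_pullback[OF A T] by simp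
qed

text \<open>All sections of a line-free set over its last \<open>N\<close> coordinates are
  line-free, so averaging over prefixes transfers the density bound to longer words.\<close>

lemma line_free_card_less_mono:
  fixes \<rho> :: real
  assumes k: "0 < k" and N: "\<And>A. line_free k N A \<Longrightarrow> card A < \<rho> * real k ^ N"
    and n: "n \<ge> N" and A: "line_free k n A"
  shows "card A < \<rho> * real k ^ n"
proof -
  obtain p where p: "n = p + N" using n by (metis add.commute le_Suc_ex)
  have A': "line_free k (p + N) A" "A \<subseteq> words k (p + N)" using A p by (auto simp: line_free_def)
  have ne: "words k p \<noteq> {}" using k card_words[of k p] by fastforce
  have "real (card A) = (\<Sum>x\<in>words k p. real (card {y\<in>words k N. x @ y \<in> A}))"
    by (rule card_sections[OF A'(2)])
  also have "\<dots> < (\<Sum>x\<in>words k p. \<rho> * real k ^ N)"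
    using ne by (intro sum_strict_mono N line_free_section[OF A'(1)]) auto
  also have "\<dots> = \<rho> * real k ^ n" by (simp add: p power_add)
  finally show ?thesis .
qed

text \<open>\<open>d\<close> is the supremum of the densities that line-free sets reach at every
  length. Since extremal densities do not increase with the length, every larger density fails from
  some length on.\<close>

lemma critical_density:
  assumes k: "0 < k" and "\<not> dhj k"
  obtains d :: real where "0 < d"
    "\<And>\<epsilon> n. 0 < \<epsilon> \<Longrightarrow> \<exists>A. line_free k n A \<and> card A \<ge> (d - \<epsilon>) * real k ^ n"
    "\<And>\<epsilon>. 0 < \<epsilon> \<Longrightarrow> \<exists>N. \<forall>n\<ge>N. \<forall>A. line_free k n A \<longrightarrow> card A < (d + \<epsilon>) * real k ^ n"
proof -
  define S :: "real set" where "S = {\<delta>. \<forall>n. \<exists>A. line_free k n A \<and> card A \<ge> \<delta> * real k ^ n}"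
  from assms(2) obtain \<delta> where \<delta>: "\<delta> > 0" and ex:
      "\<forall>n\<^sub>0. \<exists>n\<ge>n\<^sub>0. \<exists>A\<subseteq>words k n. real (card A) \<ge> \<delta> * real k ^ n \<and>
     \<not> (\<exists>T\<in>tmpl k 1 n. \<forall>i<k. sub k T [i] \<in> A)" unfolding dhj_def not_all not_ex not_imp by metis
  \<comment> \<open>By monotonicity a density reached at arbitrarily large lengths is reached at
    every length.\<close>
  have "\<exists>A. line_free k n A \<and> card A \<ge> \<delta> * real k ^ n" for n
  proof (rule ccontr)
    assume "\<not> ?thesis"
    hence *: "card A < \<delta> * real k ^ n" if "line_free k n A" for A using that not_le by blast
    obtain n' A where "n' \<ge> n" "line_free k n' A" "real (card A) \<ge> \<delta> * real k ^ n'"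
      using spec[OF ex, of n] unfolding line_free_def by meson
    thus False using line_free_card_less_mono[OF k *] by (meson not_le)
  qed
  hence S: "\<delta> \<in> S" by (simp add: S_def)
  have bdd: "bdd_above S"
  proof (rule bdd_aboveI[of _ 1])
    fix \<rho> assume "\<rho> \<in> S"
    then obtain A where "line_free k 0 A" "card A \<ge> \<rho> * real k ^ 0" unfolding S_def by blast
    thus "\<rho> \<le> 1" using real_card_le_power[of A k 0] by (simp add: line_free_def)
  qed
  define d where "d = Sup S"
  have "\<delta> \<le> d" unfolding d_def by (rule cSup_upper[OF S bdd])
  show ?thesis
  proof (rule that)
    show "0 < d" using \<open>\<delta> \<le> d\<close> \<delta> by simp
    fix \<epsilon> :: real assume \<epsilon>: "0 < \<epsilon>"
    have "d - \<epsilon> < Sup S" using \<epsilon> by (simp add: d_def)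
    then obtain \<rho> where \<rho>: "\<rho> \<in> S" "d - \<epsilon> < \<rho>" using less_cSup_iff[OF _ bdd] S by blast
    show "\<exists>A. line_free k n A \<and> card A \<ge> (d - \<epsilon>) * real k ^ n" for n
    proof -
      obtain A where "line_free k n A" "card A \<ge> \<rho> * real k ^ n" using \<rho>(1) unfolding S_def by blast
      moreover have "(d - \<epsilon>) * real k ^ n \<le> \<rho> * real k ^ n" using \<rho>(2) by (intro mult_right_mono) auto
      ultimately show ?thesis by force
    qed
    have "d + \<epsilon> \<notin> S" using cSup_upper[OF _ bdd, of "d + \<epsilon>"] \<epsilon> by (auto simp: d_def)
    then obtain N where "\<And>A. line_free k N A \<Longrightarrow> card A < (d + \<epsilon>) * real k ^ N"
      unfolding S_def by (auto simp: not_le)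
    thus "\<exists>N. \<forall>n\<ge>N. \<forall>A. line_free k n A \<longrightarrow> card A < (d + \<epsilon>) * real k ^ n"
      using line_free_card_less_mono[OF k] by blast
  qed
qed

lemma dhj_1: "dhj (Suc 0)"
  unfolding dhj_def
proof (intro allI impI exI[of _ 1])
  fix \<delta> :: real and n A assume *: "0 < \<delta>" "1 \<le> n" "A \<subseteq> words (Suc 0) n" "\<delta> * real (Suc 0) ^ n \<le> card A"
  hence "A \<noteq> {}" by auto
  then obtain x where x: "x \<in> A" by blast
  hence "x = replicate n 0" using *(3) by (intro replicate_eqI) (auto simp: words_def)
  moreover have "sub (Suc 0) (replicate n 1) [0] = replicate n 0" by (simp add: sub_def)
  moreover have "replicate n 1 \<in> tmpl (Suc 0) 1 n" using *(2) by (auto simp: tmpl_def)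
  ultimately show "\<exists>T\<in>tmpl (Suc 0) 1 n. \<forall>i<Suc 0. sub (Suc 0) T [i] \<in> A"
    using x by (intro bexI[of _ "replicate n 1"]) auto
qed

section \<open>The contradiction from a density increment\<close>

lemma sum_card_swap:
  assumes "finite X" "finite Y"
  shows "(\<Sum>x\<in>X. real (card {y\<in>Y. P x y})) = (\<Sum>y\<in>Y. real (card {x\<in>X. P x y}))"
proof -
  have "(\<Sum>x\<in>X. real (card {y\<in>Y. P x y})) = (\<Sum>x\<in>X. \<Sum>y\<in>Y. of_bool (P x y))"
    using assms by (intro sum.cong refl) (subst real_card_eq_sum[of Y], auto intro: sum.cong)
  also have "\<dots> = (\<Sum>y\<in>Y. \<Sum>x\<in>X. of_bool (P x y))" by (rule sum.swap)
  also have "\<dots> = (\<Sum>y\<in>Y. real (card {x\<in>X. P x y}))"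
    using assms by (intro sum.cong refl) (subst real_card_eq_sum[of X], auto intro: sum.cong)
  finally show ?thesis .
qed

text \<open>Turning each \<open>k\<close> in \<open>x\<close> into a variable gives a line whose
  points are the merges of \<open>x\<close> together with \<open>x\<close> itself as the last
  one.\<close>

lemma no_line_through:
  assumes A: "line_free (Suc k) (l + n) A" and x: "x \<in> words (Suc k) l" "k \<in> set x" and y: "y \<in> words (Suc k) n"
    and mem: "\<And>i. i < k \<Longrightarrow> map (merge k i) x @ y \<in> A"
  shows "x @ y \<notin> A"
proof
  assume xy: "x @ y \<in> A"
  define T where "T = map (\<lambda>s. if s = k then Suc k else s) x"
  have "T \<in> tmpl (Suc k) 1 l" using x by (auto simp: T_def tmpl_def words_def)
  hence T: "T @ y \<in> tmpl (Suc k) 1 (l + n)" using y by (rule tmpl_append_words)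
  have sub: "sub (Suc k) (T @ y) [a] = map (merge k a) x @ y" for a
    unfolding sub_append sub_words_const[OF y] using x by (auto simp: sub_def T_def merge_def words_def)
  have "map (merge k k) x = x" by (rule map_idI) (simp add: merge_def)
  hence "\<forall>a<Suc k. sub (Suc k) (T @ y) [a] \<in> A" using mem xy by (auto simp: sub less_Suc_eq)
  thus False using A T unfolding line_free_def by blast
qed

text \<open>The complement of \<open>\<Inter>i<k. C i\<close> splits according to the first \<open>i\<close> with \<open>x \<notin> C i\<close>, and each piece
  is again an intersection of \<open>k\<close> insensitive sets.\<close>

lemma sum_complement_Inter_le:
  fixes f :: "nat list \<Rightarrow> real"
  assumes C: "\<And>i. i < k \<Longrightarrow> insens k i m (C i)"
    and le: "\<And>D. (\<And>i. i < k \<Longrightarrow> insens k i m (D i)) \<Longrightarrow> (\<Sum>x\<in>(\<Inter>i<k. D i) \<inter> words (Suc k) m. f x) \<le> b"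
  shows "(\<Sum>x\<in>words (Suc k) m - (\<Inter>i<k. C i). f x) \<le> k * b"
proof -
  define E where "E i = {x\<in>words (Suc k) m. x \<notin> C i \<and> (\<forall>j<i. x \<in> C j)}" for i
  have "words (Suc k) m - (\<Inter>i<k. C i) = (\<Union>i<k. E i)"
  proof (intro equalityI subsetI)
    fix x assume x: "x \<in> words (Suc k) m - (\<Inter>i<k. C i)"
    then obtain i where i: "i < k" "x \<notin> C i" by blast
    define i' where "i' = (LEAST i. x \<notin> C i)"
    have "x \<notin> C i'" unfolding i'_def using i(2) by (rule LeastI)
    moreover have "i' \<le> i" unfolding i'_def using i(2) by (rule Least_le)
    moreover have "x \<in> C j" if "j < i'" for j using not_less_Least[OF that[unfolded i'_def]] by blast
    ultimately show "x \<in> (\<Union>i<k. E i)" using x i(1) by (auto simp: E_def intro!: bexI[of _ i'])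
  qed (auto simp: E_def)
  moreover have "E i \<inter> E j = {}" if "i \<noteq> j" for i j
    using that by (cases i j rule: linorder_cases) (auto simp: E_def)
  ultimately have "(\<Sum>x\<in>words (Suc k) m - (\<Inter>i<k. C i). f x) = (\<Sum>i<k. \<Sum>x\<in>E i. f x)"
    by (simp only:) (rule sum.UNION_disjoint, auto simp: E_def)
  also have "\<dots> \<le> (\<Sum>i<k. b)"
  proof (rule sum_mono)
    fix i assume i: "i \<in> {..<k}"
    \<comment> \<open>Indices above \<open>i\<close> impose no condition; the universal set fills
      their places.\<close>
    define D where "D j = (if j < i then C j else if j = i then - C j else UNIV)" for j
    have "E i = (\<Inter>j<k. D j) \<inter> words (Suc k) m"
      using i by (auto simp: E_def D_def split: if_splits)
    moreover have "insens k j m (D j)" if "j < k" for j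
    proof -
      have "insens k j m UNIV" unfolding insens_def by blast
      thus ?thesis using C[OF that] insens_Compl[OF C[OF that]] unfolding D_def by presburger
    qed
    ultimately show "(\<Sum>x\<in>E i. f x) \<le> b" using le[of D] by simp
  qed
  finally show ?thesis by simp
qed

text \<open>Some tail \<open>y\<close> gives a line-free section \<open>B y\<close> of a subspace
  that is nearly critical yet misses the set \<open>CC y\<close> of proportion about
  \<open>\<theta>\<close>. So its density on the complement exceeds \<open>d + \<tau>\<close>, while
  that complement is covered up to a small error by \<open>N\<close>-dimensional subspaces on which
  the density is below \<open>d + \<tau>\<close>.\<close>

theorem dhj_Suc:
  assumes k: "0 < k" and dhj: "dhj k"
  shows "dhj (Suc k)"
proof (rule ccontr)
  let ?K = "Suc k"
  assume "\<not> dhj ?K"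
  from critical_density[OF zero_less_Suc this] obtain d :: real where d: "0 < d"
    and dense: "\<And>\<epsilon> n. 0 < \<epsilon> \<Longrightarrow> \<exists>A. line_free ?K n A \<and> card A \<ge> (d - \<epsilon>) * real ?K ^ n"
    and sparse: "\<And>\<epsilon>. 0 < \<epsilon> \<Longrightarrow> \<exists>N. \<forall>n\<ge>N. \<forall>A. line_free ?K n A \<longrightarrow> card A < (d + \<epsilon>) * real ?K ^ n"
    by blast
  have d4: "d / 4 > 0" using d by simp
  from dhj[unfolded dhj_def, rule_format, OF d4] obtain m\<^sub>0 where
    "\<forall>n\<ge>m\<^sub>0. \<forall>A\<subseteq>words k n. real (card A) \<ge> d / 4 * real k ^ n \<longrightarrow> (\<exists>T\<in>tmpl k 1 n. \<forall>i<k. sub k T [i] \<in> A)"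
    by (rule exE)
  note m0 = this[rule_format, OF order_refl]
  define Ts where "Ts = tmpl k 1 m\<^sub>0"
  define \<theta> where "\<theta> = min 1 (d / (4 * (real (card Ts) + 1)))"
  have \<theta>: "0 < \<theta>" "\<theta> \<le> 1" "\<theta> \<le> d / (4 * (real (card Ts) + 1))"
    unfolding \<theta>_def by (simp add: d add_nonneg_pos, rule min.cobounded1, rule min.cobounded2)
  \<comment> \<open>The gain \<open>(d - \<tau>) - (d + \<tau>) * (1 - \<theta>)\<close> is at least
    \<open>d * \<theta> - 2 * \<tau> = d * \<theta> / 2\<close>; the errors \<open>b\<close> of the
    \<open>k\<close> pieces will sum to only half of that.\<close>
  define \<tau> where "\<tau> = d * \<theta> / 4"
  have \<tau>: "0 < \<tau>" using d \<theta> by (simp add: \<tau>_def)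
  have \<tau>d: "\<tau> \<le> d / 2" using mult_left_mono[OF \<theta>(2), of d] d by (simp add: \<tau>_def)
  \<comment> \<open>Sizes are fixed in the order \<open>N\<close>, \<open>m\<close>,
    \<open>l\<close>, \<open>n\<close>. The first \<open>l\<close> coordinates will contain a
    subspace of dimension \<open>m\<close>, which is filled with subspaces of dimension
    \<open>N\<close>.\<close>
  from sparse[OF \<tau>] obtain N where N: "\<And>A. line_free ?K N A \<Longrightarrow> card A < (d + \<tau>) * real ?K ^ N" by blast
  define b where "b = d * \<theta> / (4 * k)"
  have b: "0 < b" using d \<theta> k by (simp add: b_def)
  from sum_insens_Inter_le[OF k dhj order_refl b, of N] obtain m where
    "\<forall>n\<ge>m. \<forall>(f :: nat list \<Rightarrow> real) \<epsilon> D. 0 \<le> \<epsilon> \<longrightarrow> (\<forall>x\<in>words ?K n. f x \<le> 1) \<longrightarrow>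
      (\<forall>T\<in>tmpl ?K N n. (\<Sum>w\<in>words ?K N. f (sub ?K T w)) \<le> \<epsilon> * real ?K ^ N) \<longrightarrow>
      (\<forall>i<k. insens k i n (D i)) \<longrightarrow>
      (\<Sum>x\<in>(\<Inter>i<k. D i) \<inter> words ?K n. f x) \<le> (\<epsilon> + b) * real ?K ^ n" by (rule exE)
  note m = this[rule_format, OF order_refl]
  from good_subspace[OF k, of m\<^sub>0 m] obtain l where
    "\<forall>good::nat list \<Rightarrow> bool.
    (\<forall>T\<in>tmpl ?K m\<^sub>0 l. k \<notin> set T \<longrightarrow> (\<exists>x\<in>words ?K m\<^sub>0. k \<in> set x \<and> good (sub ?K T x))) \<longrightarrow>
    (\<exists>V\<in>tmpl ?K m l. \<forall>w\<in>words ?K m. k \<in> set (sub ?K V w) \<and> good (sub ?K V w))" by (rule exE)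
  note l = this[rule_format]
  define \<epsilon> where "\<epsilon> = \<tau> / (2 * real ?K ^ l)"
  have \<epsilon>: "0 < \<epsilon>" using \<tau> by (simp add: \<epsilon>_def)
  from sparse[OF \<epsilon>] obtain n where n: "\<And>A. line_free ?K n A \<Longrightarrow> card A < (d + \<epsilon>) * real ?K ^ n" by blast
  from dense[OF \<epsilon>] obtain A where A: "line_free ?K (l + n) A" "card A \<ge> (d - \<epsilon>) * real ?K ^ (l + n)" by blast
  \<comment> \<open>All other sections have density below \<open>d + \<epsilon>\<close>, so with an
    almost critical total no single section can fall short by more than \<open>\<tau>\<close>; the
    factor \<open>real ?K ^ l\<close> in \<open>\<epsilon>\<close> pays for concentrating the whole
    deficit on one section.\<close>
  have sec: "real (card {y\<in>words ?K n. x @ y \<in> A}) \<ge> (d - \<tau>) * real ?K ^ n" if x: "x \<in> words ?K l" for x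
  proof -
    have "real (card A) = (\<Sum>x\<in>words ?K l. real (card {y\<in>words ?K n. x @ y \<in> A}))"
      using A(1) by (intro card_sections) (simp add: line_free_def)
    also have "\<dots> = real (card {y\<in>words ?K n. x @ y \<in> A}) +
        (\<Sum>x\<in>words ?K l - {x}. real (card {y\<in>words ?K n. x @ y \<in> A}))"
      using x by (intro sum.remove) auto
    also have "(\<Sum>x\<in>words ?K l - {x}. real (card {y\<in>words ?K n. x @ y \<in> A})) \<le>
        (\<Sum>x\<in>words ?K l - {x}. (d + \<epsilon>) * real ?K ^ n)"
      by (intro sum_mono less_imp_le n line_free_section[OF A(1)]) auto
    also have "\<dots> = (real ?K ^ l - 1) * ((d + \<epsilon>) * real ?K ^ n)"
      using x by (simp add: card_Diff_singleton of_nat_diff one_le_power)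
    finally have "(d - \<epsilon>) * real ?K ^ (l + n) \<le> real (card {y\<in>words ?K n. x @ y \<in> A}) +
        (real ?K ^ l - 1) * ((d + \<epsilon>) * real ?K ^ n)" using A(2) by simp
    hence ge: "real (card {y\<in>words ?K n. x @ y \<in> A}) \<ge> (d + \<epsilon> - 2 * real ?K ^ l * \<epsilon>) * real ?K ^ n"
      by (simp add: algebra_simps power_add)
    have eq: "2 * real ?K ^ l * \<epsilon> = \<tau>" by (simp add: \<epsilon>_def)
    have "(d - \<tau>) * real ?K ^ n \<le> (d + \<epsilon> - \<tau>) * real ?K ^ n"
      using \<epsilon> by (intro mult_right_mono) auto
    also have "\<dots> \<le> real (card {y\<in>words ?K n. x @ y \<in> A})" using ge unfolding eq .
    finally show ?thesis .
  qed
  define good where "good x \<longleftrightarrow> real (card {y\<in>words ?K n. \<forall>i<k. map (merge k i) x @ y \<in> A}) \<ge> \<theta> * real ?K ^ n" for x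
  have "\<exists>x\<in>words ?K m\<^sub>0. k \<in> set x \<and> good (sub ?K T x)" if T: "T \<in> tmpl ?K m\<^sub>0 l" "k \<notin> set T" for T
  proof -
    \<comment> \<open>For many tails \<open>y\<close> the words over \<open>k\<close> letters
      landing in \<open>A\<close> are dense enough for the theorem over \<open>k\<close> letters.
      Pigeonhole yields one line \<open>S\<close> good for a proportion \<open>\<theta>\<close> of
      the tails, and as a word over \<open>k + 1\<close> letters \<open>S\<close> contains
      \<open>k\<close>.\<close>
    define g where "g y = real (card {w\<in>words k m\<^sub>0. sub ?K T w @ y \<in> A}) / real k ^ m\<^sub>0" for y
    define R where "R y S \<longleftrightarrow> (\<forall>i<k. sub ?K T (sub k S [i]) @ y \<in> A)" for y S
    have ne: "words ?K n \<noteq> {}" using card_words[of ?K n] by fastforce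
    have finTs: "finite Ts" by (simp add: Ts_def)
    have g1: "g y \<le> 1" for y unfolding g_def by (rule section_density_le_1)
    have d2: "d / 2 > 0" using d by simp
    have avg: "(\<Sum>y\<in>words ?K n. g y) \<ge> d / 2 * card (words ?K n)"
    proof -
      have "d / 2 * card (words ?K n) \<le> (d - \<tau>) * real ?K ^ n"
        using \<tau>d by (simp del: of_nat_Suc)
      also have "\<dots> = (\<Sum>w\<in>words k m\<^sub>0. (d - \<tau>) * real ?K ^ n) / real k ^ m\<^sub>0"
        using k by simp
      also have "\<dots> \<le> (\<Sum>w\<in>words k m\<^sub>0. real (card {y\<in>words ?K n. sub ?K T w @ y \<in> A})) / real k ^ m\<^sub>0"
        by (intro divide_right_mono sum_mono sec sub_words[OF T(1)]) (auto intro: words_mono)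
      also have "\<dots> = (\<Sum>y\<in>words ?K n. g y)"
        unfolding g_def sum_divide_distrib[symmetric] by (subst sum_card_swap) auto
      finally show ?thesis .
    qed
    have ex: "\<exists>S\<in>Ts. R y S" if y: "y \<in> words ?K n" "g y \<ge> d / 2 / 2" for y
    proof -
      have "\<exists>S\<in>tmpl k 1 m\<^sub>0. \<forall>i<k. sub k S [i] \<in> {w\<in>words k m\<^sub>0. sub ?K T w @ y \<in> A}"
        by (rule m0) (use y(2) k in \<open>auto simp: g_def field_simps\<close>)
      thus ?thesis by (auto simp: R_def Ts_def)
    qed
    obtain S where S: "S \<in> Ts" "card {y\<in>words ?K n. R y S} \<ge> d / 2 / (2 * card Ts) * card (words ?K n)"
      by (rule markov_pigeonhole[OF finite_words finTs ne d2 g1 avg ex])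
    have Sw: "S \<in> words ?K m\<^sub>0" "k \<in> set S" using S(1) by (auto simp: Ts_def tmpl_def words_def)
    have "map (merge k i) (sub ?K T S) = sub ?K T (sub k S [i])" for i
      using map_merge_sub_no_const[OF T(1) length_words[OF Sw(1)] T(2)] sub_eq_map_merge[OF Sw(1)] by simp
    hence eq: "{y\<in>words ?K n. R y S} = {y\<in>words ?K n. \<forall>i<k. map (merge k i) (sub ?K T S) @ y \<in> A}"
      by (simp add: R_def)
    have "card Ts > 0" using S(1) finTs by (auto simp: card_gt_0_iff)
    hence "d / (4 * (real (card Ts) + 1)) \<le> d / 2 / (2 * card Ts)"
      using d by (simp add: field_simps)
    hence "\<theta> * real ?K ^ n \<le> d / 2 / (2 * card Ts) * real ?K ^ n" using \<theta>(3) by (intro mult_right_mono) auto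
    hence "good (sub ?K T S)" using S(2) unfolding good_def eq[symmetric] by simp
    thus ?thesis using Sw by blast
  qed
  from l[OF this] obtain V where V: "V \<in> tmpl ?K m l"
    and Vk: "\<And>w. w \<in> words ?K m \<Longrightarrow> k \<in> set (sub ?K V w)"
    and Vgood: "\<And>w. w \<in> words ?K m \<Longrightarrow> good (sub ?K V w)" by blast
  define B where "B y = {w\<in>words ?K m. sub ?K V w @ y \<in> A}" for y
  define C where "C y i = {w. map (merge k i) (sub ?K V w) @ y \<in> A}" for y i
  define CC where "CC y = {w\<in>words ?K m. \<forall>i<k. map (merge k i) (sub ?K V w) @ y \<in> A}" for y
  have sumB: "(\<Sum>y\<in>words ?K n. real (card (B y))) \<ge> (d - \<tau>) * real ?K ^ m * real ?K ^ n"
  proof -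
    have "(\<Sum>w\<in>words ?K m. (d - \<tau>) * real ?K ^ n) \<le> (\<Sum>w\<in>words ?K m. real (card {y\<in>words ?K n. sub ?K V w @ y \<in> A}))"
      by (intro sum_mono sec sub_words[OF V])
    thus ?thesis unfolding B_def by (subst sum_card_swap) (auto simp: algebra_simps)
  qed
  have sumC: "(\<Sum>y\<in>words ?K n. real (card (CC y))) \<ge> \<theta> * real ?K ^ m * real ?K ^ n"
  proof -
    have "(\<Sum>w\<in>words ?K m. \<theta> * real ?K ^ n) \<le>
      (\<Sum>w\<in>words ?K m. real (card {y\<in>words ?K n. \<forall>i<k. map (merge k i) (sub ?K V w) @ y \<in> A}))"
      by (intro sum_mono) (use Vgood in \<open>simp add: good_def\<close>)
    thus ?thesis unfolding CC_def by (subst sum_card_swap) (auto simp: algebra_simps)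
  qed
  \<comment> \<open>The inequality holds on average over \<open>y\<close>, by \<open>sumB\<close>
    and \<open>sumC\<close>.\<close>
  have "\<exists>y\<in>words ?K n. card (B y) - (d + \<tau>) * (real ?K ^ m - card (CC y)) \<ge> d * \<theta> / 2 * real ?K ^ m"
  proof (rule ccontr)
    assume "\<not> ?thesis"
    hence "(\<Sum>y\<in>words ?K n. card (B y) - (d + \<tau>) * (real ?K ^ m - card (CC y))) < (\<Sum>y\<in>words ?K n. d * \<theta> / 2 * real ?K ^ m)"
      using card_words[of ?K n] by (intro sum_strict_mono) fastforce+
    hence *: "(\<Sum>y\<in>words ?K n. card (B y) - (d + \<tau>) * (real ?K ^ m - card (CC y))) < d * \<theta> / 2 * (real ?K ^ m * real ?K ^ n)"
      by (simp add: algebra_simps)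
    have "d * \<theta> / 2 * (real ?K ^ m * real ?K ^ n) \<le> (d * \<theta> - 2 * \<tau> + \<tau> * \<theta>) * (real ?K ^ m * real ?K ^ n)"
    proof (rule mult_right_mono)
      have "\<tau> * \<theta> \<ge> 0" using \<tau> \<theta> by simp
      moreover have "2 * \<tau> = d * \<theta> / 2" by (simp add: \<tau>_def)
      ultimately show "d * \<theta> / 2 \<le> d * \<theta> - 2 * \<tau> + \<tau> * \<theta>" by linarith
    qed simp
    also have "\<dots> = (d - \<tau>) * (real ?K ^ m * real ?K ^ n) -
        (d + \<tau>) * (real ?K ^ m * real ?K ^ n - \<theta> * (real ?K ^ m * real ?K ^ n))"
      by (simp add: algebra_simps)
    also have "\<dots> \<le> (\<Sum>y\<in>words ?K n. real (card (B y))) -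
        (d + \<tau>) * (real ?K ^ m * real ?K ^ n - (\<Sum>y\<in>words ?K n. real (card (CC y))))"
      using sumB sumC d \<tau> by (intro diff_mono mult_left_mono) (auto simp: mult.assoc)
    also have "\<dots> = (\<Sum>y\<in>words ?K n. card (B y) - (d + \<tau>) * (real ?K ^ m - card (CC y)))"
      by (simp add: sum_subtractf sum_distrib_left[symmetric] mult.commute)
    finally show False using * by simp
  qed
  then obtain y where y: "y \<in> words ?K n"
    "card (B y) - (d + \<tau>) * (real ?K ^ m - card (CC y)) \<ge> d * \<theta> / 2 * real ?K ^ m" by blast
  have lfB: "line_free ?K m (B y)"
  proof -
    have "sub ?K (V @ y) w = sub ?K V w @ y" for w by (simp add: sub_append sub_words_const[OF y(1)])
    thus ?thesis using line_free_pullback[OF A(1) tmpl_append_words[OF V y(1)]] by (simp add: B_def)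
  qed
  have disj: "B y \<inter> CC y = {}"
    using no_line_through[OF A(1) sub_words[OF V] Vk y(1)] by (auto simp: B_def CC_def)
  \<comment> \<open>This balanced indicator has negative sum on every \<open>N\<close>-dimensional
    subspace because \<open>B y\<close> is line-free.\<close>
  define f where "f x = of_bool (x \<in> B y) - (d + \<tau>)" for x
  have insC: "insens k i m (C y i)" if "i < k" for i
    unfolding insens_def
  proof (intro ballI impI)
    fix x x' assume x: "x \<in> words ?K m" "x' \<in> words ?K m" "map (merge k i) x = map (merge k i) x'" "x \<in> C y i"
    thus "x' \<in> C y i" using map_merge_sub_cong[OF V x(1-3)] by (simp add: C_def)
  qed
  have "(\<Sum>x\<in>words ?K m - (\<Inter>i<k. C y i). f x) \<le> k * ((0 + b) * real ?K ^ m)"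
  proof (rule sum_complement_Inter_le[OF insC])
    fix D :: "nat \<Rightarrow> nat list set" assume D: "\<And>i. i < k \<Longrightarrow> insens k i m (D i)"
    show "(\<Sum>x\<in>(\<Inter>i<k. D i) \<inter> words ?K m. f x) \<le> (0 + b) * real ?K ^ m"
    proof (rule m[OF order_refl _ _ D])
      show "f x \<le> 1" for x using d \<tau> by (simp add: f_def)
      fix T assume T: "T \<in> tmpl ?K N m"
      have "card {w\<in>words ?K N. sub ?K T w \<in> B y} < (d + \<tau>) * real ?K ^ N"
        by (rule N[OF line_free_pullback[OF lfB T]])
      moreover have "real (card {w\<in>words ?K N. sub ?K T w \<in> B y}) = (\<Sum>w\<in>words ?K N. of_bool (sub ?K T w \<in> B y))"
        by (subst real_card_eq_sum[of "words ?K N"]) (auto intro: sum.cong)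
      ultimately show "(\<Sum>w\<in>words ?K N. f (sub ?K T w)) \<le> 0 * real ?K ^ N"
        unfolding f_def sum_subtractf by (simp add: mult.commute)
    qed
  qed
  also have "k * ((0 + b) * real ?K ^ m) = d * \<theta> / 4 * real ?K ^ m" using k by (simp add: b_def)
  finally have upper: "(\<Sum>x\<in>words ?K m - (\<Inter>i<k. C y i). f x) \<le> d * \<theta> / 4 * real ?K ^ m" .
  have eq: "words ?K m - (\<Inter>i<k. C y i) = words ?K m - CC y" by (auto simp: CC_def C_def)
  have CCw: "CC y \<subseteq> words ?K m" and Bw: "B y \<subseteq> words ?K m - CC y" using disj by (auto simp: CC_def B_def)
  have "real (card (B y)) = (\<Sum>x\<in>words ?K m - CC y. of_bool (x \<in> B y))"
    by (rule real_card_eq_sum[OF _ Bw]) simp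
  moreover have "real (card (words ?K m - CC y)) = real ?K ^ m - card (CC y)"
    using card_mono[OF finite_words CCw]
    by (subst card_Diff_subset[OF finite_subset[OF CCw finite_words] CCw]) (simp add: of_nat_diff)
  ultimately have sum_f: "(\<Sum>x\<in>words ?K m - CC y. f x) = card (B y) - (d + \<tau>) * (real ?K ^ m - card (CC y))"
    unfolding f_def sum_subtractf by (simp add: mult.commute)
  have "d * \<theta> / 2 * real ?K ^ m \<le> d * \<theta> / 4 * real ?K ^ m"
    using y(2) upper unfolding eq sum_f by (rule order_trans)
  moreover have "d * \<theta> / 4 * real ?K ^ m < d * \<theta> / 2 * real ?K ^ m" using d \<theta> by (intro mult_strict_right_mono) auto
  ultimately show False by simp
qed

theorem density_hales_jewett: "0 < k \<Longrightarrow> dhj k"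
  by (induction k rule: nat_induct_non_zero) (auto simp: dhj_1 dhj_Suc)

section \<open>Szemeredi's theorem\<close>

text \<open>Raising the letter by one raises the digit sum by the number of wildcards, which becomes
  the gap of the progression.\<close>

lemma sum_list_sub_line:
  "set T \<subseteq> {..k} \<Longrightarrow> sum_list (sub k T [i]) = sum_list (sub k T [0]) + i * count_list T k"
  by (induction T) (auto simp: sub_def)

lemma sum_list_le_length: "set w \<subseteq> {..<k} \<Longrightarrow> sum_list w \<le> k * length w"
  by (induction w) auto

lemma sum_list_words_le: "w \<in> words k n \<Longrightarrow> sum_list w \<le> k * n"
  using sum_list_le_length by (auto simp: words_def)

text \<open>A translate of \<open>E\<close> pulls back under the digit sum to a dense set of words, and the digit sum maps
  combinatorial lines to arithmetic progressions.\<close>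

theorem szemeredi:
  fixes \<epsilon> :: real and k :: nat
  assumes k: "0 < k" and \<epsilon>: "0 < \<epsilon>"
  shows "\<exists>N\<^sub>0. \<forall>N\<ge>N\<^sub>0. \<forall>E\<subseteq>{..<N::nat}. real (card E) \<ge> \<epsilon> * N \<longrightarrow> (\<exists>a g. 1 \<le> g \<and> (\<forall>i<k. a + i * g \<in> E))"
proof -
  have "\<epsilon> / 2 > 0" using \<epsilon> by simp
  from density_hales_jewett[OF k, unfolded dhj_def, rule_format, OF this] obtain n where
    "\<forall>m\<ge>n. \<forall>A\<subseteq>words k m. real (card A) \<ge> \<epsilon> / 2 * real k ^ m \<longrightarrow> (\<exists>T\<in>tmpl k 1 m. \<forall>i<k. sub k T [i] \<in> A)"
    by (rule exE)
  note n = this[rule_format, OF order_refl]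
  show ?thesis
  proof (rule exI[of _ "max 1 (k * n)"], intro allI impI)
    fix N and E :: "nat set"
    assume N: "max 1 (k * n) \<le> N" and E: "E \<subseteq> {..<N}" "real (card E) \<ge> \<epsilon> * N"
    \<comment> \<open>The shift by \<open>k * n\<close> keeps all translates of \<open>E\<close>
      within the natural numbers.\<close>
    define P where "P a w \<longleftrightarrow> k * n \<le> a + sum_list w \<and> a + sum_list w - k * n \<in> E" for a w
    have "\<exists>a\<in>{..<N + k * n}. real (card {w\<in>words k n. P a w}) \<ge> \<epsilon> / 2 * real k ^ n"
    proof (rule ccontr)
      assume "\<not> ?thesis"
      hence "(\<Sum>a<N + k * n. real (card {w\<in>words k n. P a w})) < (\<Sum>a<N + k * n. \<epsilon> / 2 * real k ^ n)"
        using N by (intro sum_strict_mono) (auto simp: not_le lessThan_empty_iff)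
      also have "\<dots> = real (N + k * n) * (\<epsilon> / 2 * real k ^ n)" by simp
      also have "\<dots> \<le> real (N + N) * (\<epsilon> / 2 * real k ^ n)"
        using N \<epsilon> by (intro mult_right_mono) (auto simp flip: of_nat_mult)
      also have "\<dots> = (\<Sum>w\<in>words k n. \<epsilon> * N)" by simp
      also have "\<dots> \<le> (\<Sum>w\<in>words k n. real (card {a\<in>{..<N + k * n}. P a w}))"
      proof (rule sum_mono)
        fix w assume "w \<in> words k n"
        hence w: "sum_list w \<le> k * n" by (rule sum_list_words_le)
        \<comment> \<open>For fixed \<open>w\<close> each element of \<open>E\<close> is hit by
          exactly one shift, so double counting finds a shift for which the words landing in
          \<open>E\<close> are dense.\<close>
        have "card E \<le> card {a\<in>{..<N + k * n}. P a w}"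
        proof (rule card_inj_on_le)
          show "inj_on (\<lambda>e. e + k * n - sum_list w) E" using w by (intro inj_onI) linarith
          show "(\<lambda>e. e + k * n - sum_list w) ` E \<subseteq> {a\<in>{..<N + k * n}. P a w}"
            using w E(1) by (auto simp: P_def subset_iff)
        qed simp
        thus "\<epsilon> * N \<le> real (card {a\<in>{..<N + k * n}. P a w})" using E(2) by simp
      qed
      also have "\<dots> = (\<Sum>a<N + k * n. real (card {w\<in>words k n. P a w}))" by (rule sum_card_swap) auto
      finally show False by simp
    qed
    then obtain a where a: "real (card {w\<in>words k n. P a w}) \<ge> \<epsilon> / 2 * real k ^ n" by blast
    have "\<exists>T\<in>tmpl k 1 n. \<forall>i<k. sub k T [i] \<in> {w\<in>words k n. P a w}" by (rule n[OF _ a]) auto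
    then obtain T where T: "T \<in> tmpl k 1 n" "\<And>i. i < k \<Longrightarrow> P a (sub k T [i])" by blast
    have Tk: "set T \<subseteq> {..k}" "k \<in> set T" using T(1) by (auto simp: tmpl_def)
    define g where "g = count_list T k"
    define s where "s = sum_list (sub k T [0])"
    have s: "k * n \<le> a + s" using T(2)[OF k] by (simp add: P_def s_def)
    show "\<exists>a g. 1 \<le> g \<and> (\<forall>i<k. a + i * g \<in> E)"
    proof (intro exI conjI allI impI)
      show "1 \<le> g" using Tk(2) count_list_0_iff[of T k] by (simp add: g_def Suc_le_eq)
      fix i assume "i < k"
      from T(2)[OF this] have "a + (s + i * g) - k * n \<in> E"
        using sum_list_sub_line[OF Tk(1), of i] by (simp add: P_def s_def g_def)
      thus "(a + s - k * n) + i * g \<in> E" using s by (simp add: add.assoc)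
    qed
  qed
qed

text \<open>Splitting a block of \<open>G N\<close> integers into residue classes modulo \<open>G\<close> forces the gap to be at least \<open>G\<close>.\<close>

lemma card_le_blocks:
  fixes \<epsilon> :: real and G N k :: nat and S :: "nat set"
  assumes G: "0 < G" and N: "0 < N" and S: "finite S"
    and szem: "\<And>E. E \<subseteq> {..<N} \<Longrightarrow> real (card E) \<ge> \<epsilon> * N \<Longrightarrow> \<exists>a g. 1 \<le> g \<and> (\<forall>i<k. a + i * g \<in> E)"
    and no_AP: "\<not> (\<exists>c g. G \<le> g \<and> (\<forall>i<k. c + i * g \<in> S))"
  shows "real (card S) \<le> \<epsilon> * real (G * N) * card ((\<lambda>x. x div (G * N)) ` S)"
proof -
  \<comment> \<open>\<open>E s r\<close> describes one residue class of one block on the scale of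
    multiples of \<open>G\<close>; a gap \<open>g\<close> in it is a gap \<open>g * G\<close> in
    \<open>S\<close>.\<close>
  define E where "E s r = {q. q < N \<and> s * (G * N) + q * G + r \<in> S}" for s r
  have E: "real (card (E s r)) \<le> \<epsilon> * N" for s r
  proof (rule ccontr)
    assume "\<not> ?thesis"
    with szem[of "E s r"] obtain a g where g: "1 \<le> g" "\<forall>i<k. a + i * g \<in> E s r" by (auto simp: E_def)
    have "(s * (G * N) + a * G + r) + i * (g * G) \<in> S" if "i < k" for i
      using g(2) that by (auto simp: E_def algebra_simps)
    moreover have "G \<le> g * G" using g(1) by simp
    ultimately show False using no_AP by blast
  qed
  have block: "real (card {x\<in>S. x div (G * N) = s}) \<le> \<epsilon> * real (G * N)" for s
  proof -
    have "{x\<in>S. x div (G * N) = s} \<subseteq> (\<Union>r<G. (\<lambda>q. s * (G * N) + q * G + r) ` E s r)"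
    proof
      fix x assume x: "x \<in> {x\<in>S. x div (G * N) = s}"
      define q where "q = x div G mod N"
      have "x = s * (G * N) + q * G + x mod G"
      proof -
        have "x div G = s * N + q" using x div_mult_mod_eq[of "x div G" N]
          by (simp add: q_def div_mult2_eq)
        thus ?thesis using div_mult_mod_eq[of x G] by (simp add: algebra_simps)
      qed
      moreover have "q < N" using N by (simp add: q_def)
      ultimately have "x \<in> (\<lambda>q. s * (G * N) + q * G + x mod G) ` E s (x mod G)"
        using x by (auto simp: E_def intro!: image_eqI[of _ _ q])
      thus "x \<in> (\<Union>r<G. (\<lambda>q. s * (G * N) + q * G + r) ` E s r)" using G by auto
    qed
    hence "card {x\<in>S. x div (G * N) = s} \<le> card (\<Union>r<G. (\<lambda>q. s * (G * N) + q * G + r) ` E s r)"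
      by (intro card_mono) (auto simp: E_def)
    also have "\<dots> \<le> (\<Sum>r<G. card ((\<lambda>q. s * (G * N) + q * G + r) ` E s r))" by (rule card_UN_le) simp
    also have "\<dots> \<le> (\<Sum>r<G. card (E s r))" by (intro sum_mono card_image_le) (simp add: E_def)
    finally have "real (card {x\<in>S. x div (G * N) = s}) \<le> (\<Sum>r<G. real (card (E s r)))"
      unfolding of_nat_sum[symmetric] of_nat_le_iff .
    also have "\<dots> \<le> (\<Sum>r<G. \<epsilon> * N)" by (intro sum_mono E)
    finally show ?thesis by (simp add: mult_ac)
  qed
  let ?I = "(\<lambda>x. x div (G * N)) ` S"
  have "card S = card (\<Union>s\<in>?I. {x\<in>S. x div (G * N) = s})" by (rule arg_cong[where f = card]) auto
  also have "\<dots> \<le> (\<Sum>s\<in>?I. card {x\<in>S. x div (G * N) = s})" by (rule card_UN_le) (use S in simp)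
  finally have "real (card S) \<le> (\<Sum>s\<in>?I. real (card {x\<in>S. x div (G * N) = s}))"
    unfolding of_nat_sum[symmetric] of_nat_le_iff .
  also have "\<dots> \<le> (\<Sum>s\<in>?I. \<epsilon> * real (G * N))" by (intro sum_mono block)
  finally show ?thesis by (simp add: mult_ac)
qed

section \<open>Approximate progressions in dyadic blocks\<close>

lemma dyadic_level:
  assumes "(1::nat) \<le> x"
  obtains n where "2 ^ n \<le> x" "x < 2 ^ (n + 1)"
  using ex_power_ivl1[OF order_refl assms] by blast

lemma div_power_bounds:
  assumes "b \<le> n" "x \<in> {2 ^ n..<2 ^ (n + 1) :: nat}"
  shows "x div 2 ^ b \<in> {2 ^ (n - b)..<2 ^ (n - b + 1)}"
proof -
  have "2 ^ n = 2 ^ (n - b) * (2 ^ b :: nat)" "2 ^ (n + 1) = 2 ^ (n - b + 1) * (2 ^ b :: nat)"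
    using assms(1) by (simp_all flip: power_add)
  thus ?thesis using assms(2) by (simp add: less_eq_div_iff_mult_less_eq div_less_iff_less_mult)
qed

lemma card_le_fibres:
  assumes "finite (B :: nat set)" "0 < m"
  shows "card B \<le> m * card ((\<lambda>x. x div m) ` B)"
proof -
  have "card B \<le> card (((\<lambda>x. x div m) ` B) \<times> {..<m})"
  proof (rule card_inj_on_le)
    show "inj_on (\<lambda>x. (x div m, x mod m)) B"
      by (rule inj_onI) (metis div_mult_mod_eq prod.inject)
  qed (use assms in auto)
  thus ?thesis using assms by (simp add: card_cartesian_product mult.commute)
qed

text \<open>The left endpoints of the cells form the progression, and each has an element of
  \<open>A\<close> in its own cell, at distance below \<open>2 ^ b\<close>.\<close>

lemma approximates_AP_cells:
  assumes k: "1 \<le> k" and g: "1 \<le> g" and cells: "\<And>i. i < k \<Longrightarrow> c + i * g \<in> (\<lambda>x. x div 2 ^ b) ` A"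
    and \<Delta>: "\<Delta> = real g * 2 ^ b" "2 ^ b \<le> \<Delta> powr \<alpha>"
  shows "approximates_AP A \<alpha> k \<Delta> {real (c + i * g) * 2 ^ b | i. i < k}"
proof -
  let ?P = "{real (c + i * g) * 2 ^ b | i. i < k}"
  have "?P = {real c * 2 ^ b + real i * \<Delta> | i. i < k}" by (simp add: \<Delta>(1) algebra_simps)
  moreover have "\<Delta> > 0" using g by (simp add: \<Delta>(1))
  ultimately have AP: "is_arith_prog k \<Delta> ?P" using k unfolding is_arith_prog_def by blast
  have "(SUP p\<in>?P. INF a\<in>A. \<bar>p - real a\<bar>) \<le> \<Delta> powr \<alpha>"
  proof (rule cSUP_least)
    show "?P \<noteq> {}" using k by (auto intro!: exI[of _ 0])
    fix p assume "p \<in> ?P"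
    then obtain i where i: "i < k" "p = real (c + i * g) * 2 ^ b" by blast
    obtain x where x: "x \<in> A" "c + i * g = x div 2 ^ b" using cells[OF i(1)] by blast
    have "p = real (x div 2 ^ b * 2 ^ b)" by (simp add: i(2) x(2))
    moreover have "x = x div 2 ^ b * 2 ^ b + x mod 2 ^ b" by (rule div_mult_mod_eq[symmetric])
    hence "real x = real (x div 2 ^ b * 2 ^ b) + real (x mod 2 ^ b)" by (metis of_nat_add)
    ultimately have "\<bar>p - real x\<bar> = real (x mod 2 ^ b)" by simp
    also have "\<dots> \<le> real (2 ^ b)" unfolding of_nat_le_iff by (intro less_imp_le mod_less_divisor) simp
    finally have "\<bar>p - real x\<bar> \<le> \<Delta> powr \<alpha>" using \<Delta>(2) by simp
    thus "(INF a\<in>A. \<bar>p - real a\<bar>) \<le> \<Delta> powr \<alpha>"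
      by (rule cINF_lower2[OF _ x(1), rotated]) (rule bdd_belowI2[of _ 0], simp)
  qed
  thus ?thesis using AP by (simp add: approximates_AP_def)
qed

text \<open>If all late blocks were sparse, summing them up to \<open>2 ^ (M + 1)\<close> would give
  order \<open>2 ^ M * M powr -(\<gamma> + 1)\<close>, too little for the hypothesis. The additional
  exponent \<open>1\<close> outweighs all constants.\<close>

lemma infinite_dense_dyadic_blocks:
  assumes \<gamma>: "0 < \<gamma>"
    and inf: "infinite {n::nat. n \<ge> 1 \<and> real (card (A \<inter> {0..n})) \<ge> real n / (ln (real n)) powr \<gamma>}"
  shows "infinite {n::nat. real (card (A \<inter> {2 ^ n..<2 ^ (n + 1)})) \<ge> 2 ^ n * real n powr -(\<gamma> + 1)}"
proof
  define B where "B n = A \<inter> {2 ^ n..<2 ^ (n + 1)}" for n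
  assume "finite {n::nat. real (card (A \<inter> {2 ^ n..<2 ^ (n + 1)})) \<ge> 2 ^ n * real n powr -(\<gamma> + 1)}"
  then obtain n\<^sub>1 where n1: "\<forall>n\<in>{n::nat. real (card (B n)) \<ge> 2 ^ n * real n powr -(\<gamma> + 1)}. n < n\<^sub>1"
    unfolding B_def finite_nat_set_iff_bounded by blast
  have sparse: "real (card (B n)) \<le> 2 ^ n * real n powr -(\<gamma> + 1)" if "n \<ge> n\<^sub>1" for n
  proof (rule ccontr)
    assume "\<not> ?thesis"
    hence "n \<in> {n::nat. real (card (B n)) \<ge> 2 ^ n * real n powr -(\<gamma> + 1)}" by simp
    thus False using n1 that by fastforce
  qed
  have "eventually (\<lambda>M::nat. 2 powr (real M / 2) + 2 powr (real M + 1) * (real M / 3) powr -(\<gamma> + 1)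
      < 2 powr real M * (real M + 1) powr -\<gamma>) sequentially"
    using \<gamma> by real_asymp
  then obtain M\<^sub>0 where M0: "\<And>M. M \<ge> M\<^sub>0 \<Longrightarrow>
    2 powr (real M / 2) + 2 powr (real M + 1) * (real M / 3) powr -(\<gamma> + 1) < 2 powr real M * (real M + 1) powr -\<gamma>"
    by (auto simp: eventually_sequentially)
  define M\<^sub>1 where "M\<^sub>1 = M\<^sub>0 + 2 * n\<^sub>1 + 2"
  obtain N where N: "N \<ge> 2 ^ M\<^sub>1" "real (card (A \<inter> {0..N})) \<ge> real N / (ln (real N)) powr \<gamma>"
    using inf unfolding infinite_nat_iff_unbounded_le by blast
  have "1 \<le> N" using N(1) one_le_power[of "2::nat" M\<^sub>1] by linarith
  then obtain M where M: "2 ^ M \<le> N" "N < 2 ^ (M + 1)" by (rule dyadic_level)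
  have "2 ^ M\<^sub>1 < (2::nat) ^ (M + 1)" using N(1) M(2) by linarith
  hence "M\<^sub>1 < M + 1" by (rule power_less_imp_less_exp[rotated]) simp
  hence MM: "M \<ge> M\<^sub>1" by simp
  \<comment> \<open>Below \<open>2 ^ m\<close> every integer is counted, at a cost of about the
    square root of \<open>N\<close>; the blocks from \<open>m\<close> on have index at least
    \<open>M / 3\<close>, so their densities obey one common bound.\<close>
  define m where "m = M div 2"
  have m: "n\<^sub>1 \<le> m" "1 \<le> m" "real m \<le> real M / 2" "real M / 3 \<le> real m" "m \<le> M" "2 \<le> M"
  proof -
    have "2 * m \<le> M" "M \<le> 2 * m + 1" "2 * n\<^sub>1 + 2 \<le> M" using MM by (simp_all add: m_def M\<^sub>1_def)
    moreover from this have "M \<le> 3 * m" by linarith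
    ultimately show "n\<^sub>1 \<le> m" "1 \<le> m" "real m \<le> real M / 2" "real M / 3 \<le> real m" "m \<le> M" "2 \<le> M"
      by linarith+
  qed
  have "A \<inter> {0..N} \<subseteq> {..<2 ^ m} \<union> (\<Union>n\<in>{m..M}. B n)"
  proof
    fix x assume x: "x \<in> A \<inter> {0..N}"
    show "x \<in> {..<2 ^ m} \<union> (\<Union>n\<in>{m..M}. B n)"
    proof (cases "x < 2 ^ m")
      case False
      hence "1 \<le> x" using one_le_power[of "2::nat" m] by linarith
      then obtain n where n: "2 ^ n \<le> x" "x < 2 ^ (n + 1)" by (rule dyadic_level)
      have "2 ^ n < (2::nat) ^ (M + 1)" "2 ^ m < (2::nat) ^ (n + 1)" using n x M False by auto
      hence "n < M + 1" "m < n + 1" by (auto intro: power_less_imp_less_exp[of "2::nat"] simp del: power_Suc)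
      hence "n \<in> {m..M}" by simp
      moreover have "x \<in> B n" using x n by (simp add: B_def)
      ultimately show ?thesis by blast
    qed simp
  qed
  hence "card (A \<inter> {0..N}) \<le> card ({..<2 ^ m} \<union> (\<Union>n\<in>{m..M}. B n))"
    by (intro card_mono) (auto simp: B_def)
  also have "\<dots> \<le> card {..<2 ^ m :: nat} + card (\<Union>n\<in>{m..M}. B n)" by (rule card_Un_le)
  also have "\<dots> \<le> 2 ^ m + (\<Sum>n\<in>{m..M}. card (B n))" by (intro add_mono card_UN_le) auto
  finally have "real (card (A \<inter> {0..N})) \<le> real (2 ^ m + (\<Sum>n\<in>{m..M}. card (B n)))" by (simp only: of_nat_le_iff)
  also have "\<dots> = 2 ^ m + (\<Sum>n\<in>{m..M}. real (card (B n)))" by simp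
  also have "\<dots> \<le> 2 ^ m + (\<Sum>n\<in>{m..M}. 2 ^ n * (real M / 3) powr -(\<gamma> + 1))"
  proof (intro add_left_mono sum_mono)
    fix n assume n: "n \<in> {m..M}"
    hence "real (card (B n)) \<le> 2 ^ n * real n powr -(\<gamma> + 1)" using m by (intro sparse) auto
    also have "real n powr -(\<gamma> + 1) \<le> (real M / 3) powr -(\<gamma> + 1)"
      using n m \<gamma> by (intro powr_mono2') auto
    finally show "real (card (B n)) \<le> 2 ^ n * (real M / 3) powr -(\<gamma> + 1)" by simp
  qed
  also have "\<dots> = 2 ^ m + (\<Sum>n\<in>{m..M}. 2 ^ n) * (real M / 3) powr -(\<gamma> + 1)" by (simp add: sum_distrib_right)
  also have "\<dots> \<le> 2 powr (real M / 2) + 2 powr (real M + 1) * (real M / 3) powr -(\<gamma> + 1)"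
  proof (intro add_mono mult_right_mono)
    have "(2::real) ^ m = 2 powr real m" by (simp add: powr_realpow)
    also have "\<dots> \<le> 2 powr (real M / 2)" using m by (intro powr_mono) auto
    finally show "(2::real) ^ m \<le> 2 powr (real M / 2)" .
    have "(\<Sum>n\<in>{m..M}. 2 ^ n) \<le> (\<Sum>n<Suc M. (2::real) ^ n)" by (intro sum_mono2) auto
    also have "\<dots> \<le> 2 ^ Suc M" using geometric_sum[of "2::real" "Suc M"] by simp
    also have "\<dots> = 2 powr real (Suc M)" by (rule powr_realpow[symmetric]) simp
    finally show "(\<Sum>n\<in>{m..M}. (2::real) ^ n) \<le> 2 powr (real M + 1)" by (simp add: add.commute)
  qed simp
  also have "\<dots> < 2 powr real M * (real M + 1) powr -\<gamma>" using MM by (intro M0) (simp add: M\<^sub>1_def)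
  also have "\<dots> \<le> real N / (ln (real N)) powr \<gamma>"
  proof -
    have N2: "2 \<le> N" using M(1) m(6) power_increasing[of 1 M "2::nat"] by simp
    have "real N \<le> real (2 ^ (M + 1))" unfolding of_nat_le_iff using M(2) by (rule less_imp_le)
    hence "ln (real N) \<le> ln (2 ^ (M + 1))" using N2 by (subst ln_le_cancel_iff) simp_all
    also have "\<dots> = (real M + 1) * ln 2" by (subst ln_realpow) simp_all
    also have "\<dots> \<le> (real M + 1) * 1" using ln_2_less_1 by (intro mult_left_mono) auto
    finally have le: "ln (real N) \<le> real M + 1" by simp
    have pos: "0 < ln (real N)" using N2 by simp
    have "2 powr real M * (real M + 1) powr -\<gamma> = 2 ^ M / (real M + 1) powr \<gamma>"
      by (simp add: powr_realpow powr_minus field_simps)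
    also have "\<dots> \<le> real N / (ln (real N)) powr \<gamma>"
    proof (intro frac_le powr_mono2)
      have "real (2 ^ M) \<le> real N" unfolding of_nat_le_iff by (rule M(1))
      thus "2 ^ M \<le> real N" by simp
    qed (use le pos \<gamma> in auto)
    finally show ?thesis .
  qed
  finally show False using N(2) by simp
qed

text \<open>Without a progression every change of scale loses a factor \<open>\<epsilon>\<close>.
  Scales grow at most by the factor \<open>l\<close>, so from \<open>sqrt n / l\<close> there is
  room for \<open>J\<close> steps with \<open>l ^ J > sqrt n\<close>, and the total loss is below
  \<open>n powr -\<gamma>\<close>.\<close>

lemma dense_dyadic_block_approximates_AP:
  fixes \<alpha> \<gamma> \<Delta>\<^sub>0 :: real and k :: nat
  assumes \<alpha>: "0 < \<alpha>" "\<alpha> < 1" and \<gamma>: "0 < \<gamma>" and k: "1 \<le> k" and \<Delta>\<^sub>0: "1 < \<Delta>\<^sub>0"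
  shows "\<exists>n\<^sub>0. \<forall>n\<ge>n\<^sub>0. \<forall>A. real (card (A \<inter> {2 ^ n..<2 ^ (n + 1)})) \<ge> 2 ^ n * real n powr -\<gamma> \<longrightarrow>
    (\<exists>P \<Delta>. \<Delta> \<ge> \<Delta>\<^sub>0 \<and> approximates_AP A \<alpha> k \<Delta> P \<and> \<Delta> \<ge> real n \<and> P \<subseteq> {2 ^ n..2 ^ (n + 1)})"
proof -
  \<comment> \<open>One step takes \<open>b\<close> to at most \<open>b / \<alpha> + 1 + t\<close>,
    and the summand \<open>1 + t\<close> is absorbed by doubling
    \<open>b / \<alpha>\<close>.\<close>
  define l where "l = 2 / \<alpha>"
  have l: "2 < l" "0 < l" using \<alpha> by (auto simp: l_def field_simps)
  \<comment> \<open>Chosen so that \<open>\<epsilon> ^ J\<close> is the power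
    \<open>-(2 * \<gamma>)\<close> of \<open>l ^ J\<close>, to be compared with
    \<open>sqrt n\<close>.\<close>
  define \<epsilon> where "\<epsilon> = l powr -(2 * \<gamma>)"
  have \<epsilon>: "0 < \<epsilon>" using l by (simp add: \<epsilon>_def)
  have k0: "0 < k" using k by simp
  from szemeredi[OF k0 \<epsilon>] obtain t where t: "\<forall>N\<ge>t. \<forall>E\<subseteq>{..<N::nat}. real (card E) \<ge> \<epsilon> * N \<longrightarrow>
    (\<exists>a g. 1 \<le> g \<and> (\<forall>i<k. a + i * g \<in> E))" by (rule exE)
  \<comment> \<open>\<open>2 ^ t\<close> exceeds the threshold \<open>t\<close>, and a power of two
    keeps all blocks dyadic.\<close>
  have szem: "\<exists>a g. 1 \<le> g \<and> (\<forall>i<k. a + i * g \<in> E)" if "E \<subseteq> {..<2 ^ t}" "real (card E) \<ge> \<epsilon> * real (2 ^ t)" for E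
    using t[rule_format, of "2 ^ t" E] that less_exp[of t] by simp
  define C where "C = max (1 + real t) (log 2 \<Delta>\<^sub>0)"
  have "eventually (\<lambda>n::nat. real n \<le> 2 powr (sqrt (real n) / l - 1)) sequentially"
    "eventually (\<lambda>n::nat. C \<le> sqrt (real n) / l - 1) sequentially"
    using l(2) by real_asymp+
  hence "eventually (\<lambda>n::nat. real n \<le> 2 powr (sqrt (real n) / l - 1) \<and> C \<le> sqrt (real n) / l - 1 \<and> 1 \<le> n) sequentially"
    by (intro eventually_conj eventually_ge_at_top)
  then obtain n\<^sub>0 where n0: "\<And>n::nat. n \<ge> n\<^sub>0 \<Longrightarrow>
      real n \<le> 2 powr (sqrt (real n) / l - 1) \<and> C \<le> sqrt (real n) / l - 1 \<and> 1 \<le> n"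
    unfolding eventually_sequentially by blast
  have main: "\<exists>P \<Delta>. \<Delta> \<ge> \<Delta>\<^sub>0 \<and> approximates_AP A \<alpha> k \<Delta> P \<and> \<Delta> \<ge> real n \<and> P \<subseteq> {2 ^ n..2 ^ (n + 1)}"
    if "n \<ge> n\<^sub>0" and dense: "real (card (A \<inter> {2 ^ n..<2 ^ (n + 1)})) \<ge> 2 ^ n * real n powr -\<gamma>" for n A
  proof (rule ccontr)
    assume no_AP: "\<not> ?thesis"
    note n = n0[OF \<open>n \<ge> n\<^sub>0\<close>]
    \<comment> \<open>Large enough for \<open>2 ^ b\<^sub>0\<close> to exceed both \<open>n\<close>
      and \<open>\<Delta>\<^sub>0\<close>, which makes all gaps long; small enough to leave many
      scales up to \<open>n\<close>.\<close>
    define b\<^sub>0 where "b\<^sub>0 = nat \<lfloor>sqrt (real n) / l\<rfloor>"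
    have "0 \<le> sqrt (real n) / l" using l by simp
    hence "real b\<^sub>0 = of_int \<lfloor>sqrt (real n) / l\<rfloor>" by (simp add: b\<^sub>0_def)
    hence b0: "real b\<^sub>0 \<le> sqrt (real n) / l" "sqrt (real n) / l - 1 \<le> real b\<^sub>0" by linarith+
    have b0_t: "1 + t \<le> b\<^sub>0" using n b0(2) unfolding C_def by linarith
    have pow_b0: "real n \<le> 2 ^ b\<^sub>0" "\<Delta>\<^sub>0 \<le> 2 ^ b\<^sub>0"
    proof -
      have eq: "(2::real) ^ b\<^sub>0 = 2 powr real b\<^sub>0" by (simp add: powr_realpow)
      have "2 powr (sqrt (real n) / l - 1) \<le> 2 powr real b\<^sub>0" using b0(2) by (intro powr_mono) auto
      thus "real n \<le> 2 ^ b\<^sub>0" using n unfolding eq by linarith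
      have "log 2 \<Delta>\<^sub>0 \<le> real b\<^sub>0" using n b0(2) unfolding C_def by linarith
      hence "2 powr (log 2 \<Delta>\<^sub>0) \<le> 2 powr real b\<^sub>0" by (intro powr_mono) auto
      thus "\<Delta>\<^sub>0 \<le> 2 ^ b\<^sub>0" unfolding eq using \<Delta>\<^sub>0 by simp
    qed
    define B where "B = A \<inter> {2 ^ n..<2 ^ (n + 1)}"
    have finB: "finite B" by (simp add: B_def)
    define cells where "cells b = (\<lambda>x. x div 2 ^ b) ` B" for b
    have fin_cells: "finite (cells b)" for b using finB by (simp add: cells_def)
    \<comment> \<open>A gap of at least \<open>2 ^ u b\<close> has \<open>\<alpha>\<close>-th power
      at least \<open>2 ^ b\<close>, the size of a cell.\<close>
    define u where "u b = nat \<lceil>real b / \<alpha>\<rceil>" for b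
    have u: "real b / \<alpha> \<le> real (u b)" "real (u b) \<le> real b / \<alpha> + 1" for b
    proof -
      have "0 \<le> real b / \<alpha>" using \<alpha> by simp
      hence "0 \<le> \<lceil>real b / \<alpha>\<rceil>" by linarith
      hence "real (u b) = of_int \<lceil>real b / \<alpha>\<rceil>" by (simp add: u_def)
      thus "real b / \<alpha> \<le> real (u b)" "real (u b) \<le> real b / \<alpha> + 1" by linarith+
    qed
    have b_u: "b \<le> u b" for b
    proof -
      have "real b \<le> real b / \<alpha>" using \<alpha> by (simp add: field_simps mult_left_le_one_le)
      thus ?thesis using u(1)[of b] by linarith
    qed
    \<comment> \<open>The block bound is applied to the cell indices with
      \<open>G = 2 ^ (u b - b)\<close> and \<open>N = 2 ^ t\<close>; a gap of \<open>G\<close> cells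
      is a real gap of \<open>2 ^ u b\<close>.\<close>
    have step: "real (card (cells b)) \<le> \<epsilon> * 2 ^ (u b + t - b) * card (cells (u b + t))"
      if b: "b\<^sub>0 \<le> b" "u b + t \<le> n" for b
    proof -
      have bn: "b \<le> n" using b(2) b_u[of b] by linarith
      have exp: "u b + t - b = (u b - b) + t" "u b + t = b + ((u b - b) + t)" using b_u[of b] by auto
      have "real (card (cells b)) \<le> \<epsilon> * real (2 ^ (u b - b) * 2 ^ t) *
          card ((\<lambda>x. x div (2 ^ (u b - b) * 2 ^ t)) ` cells b)"
      proof (rule card_le_blocks[OF _ _ fin_cells szem])
        show "\<not> (\<exists>c g. 2 ^ (u b - b) \<le> g \<and> (\<forall>i<k. c + i * g \<in> cells b))"
        proof
          assume "\<exists>c g. 2 ^ (u b - b) \<le> g \<and> (\<forall>i<k. c + i * g \<in> cells b)"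
          then obtain c g where g: "2 ^ (u b - b) \<le> g" "\<And>i. i < k \<Longrightarrow> c + i * g \<in> cells b" by blast
          define \<Delta> where "\<Delta> = real g * 2 ^ b"
          define P where "P = {real (c + i * g) * 2 ^ b | i. i < k}"
          have "(2::real) ^ u b = real (2 ^ (u b - b)) * 2 ^ b" using b_u[of b] by (simp flip: power_add)
          also have "\<dots> \<le> \<Delta>" using g(1) unfolding \<Delta>_def by (intro mult_right_mono) (simp_all only: of_nat_le_iff, simp)
          finally have \<Delta>: "2 ^ u b \<le> \<Delta>" .
          have ge: "2 ^ b\<^sub>0 \<le> \<Delta>"
          proof -
            have "(2::real) ^ b\<^sub>0 \<le> 2 ^ u b" using b(1) b_u[of b] by (intro power_increasing) auto
            thus ?thesis using \<Delta> by linarith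
          qed
          have "real b = \<alpha> * (real b / \<alpha>)" using \<alpha> by simp
          also have "\<dots> \<le> \<alpha> * real (u b)" using \<alpha> u(1) by (intro mult_left_mono) auto
          finally have "2 powr real b \<le> 2 powr (real (u b) * \<alpha>)" by (intro powr_mono) (auto simp: mult.commute)
          also have "\<dots> = (2 ^ u b) powr \<alpha>" by (simp add: powr_powr[symmetric] powr_realpow)
          also have "\<dots> \<le> \<Delta> powr \<alpha>" using \<alpha> \<Delta> by (intro powr_mono2) auto
          finally have err: "2 ^ b \<le> \<Delta> powr \<alpha>" by (simp add: powr_realpow)
          have "1 \<le> g" using g(1) one_le_power[of "2::nat" "u b - b"] by linarith
          moreover have "c + i * g \<in> (\<lambda>x. x div 2 ^ b) ` A" if "i < k" for i
            using g(2)[OF that] by (auto simp: cells_def B_def)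
          ultimately have "approximates_AP A \<alpha> k \<Delta> P" unfolding P_def
            by (intro approximates_AP_cells[OF k _ _ \<Delta>_def err])
          moreover have "P \<subseteq> {2 ^ n..2 ^ (n + 1)}"
          proof
            fix p assume "p \<in> P"
            then obtain i where i: "i < k" "p = real (c + i * g) * 2 ^ b" by (auto simp: P_def)
            obtain x where "x \<in> B" "c + i * g = x div 2 ^ b" using g(2)[OF i(1)] by (auto simp: cells_def)
            hence "c + i * g \<in> {2 ^ (n - b)..<2 ^ (n - b + 1)}"
              using div_power_bounds[OF bn, of x] by (simp add: B_def)
            hence "real (2 ^ (n - b)) \<le> real (c + i * g)" "real (c + i * g) \<le> real (2 ^ (n - b + 1))"
              unfolding of_nat_le_iff by auto
            hence "2 ^ (n - b) * 2 ^ b \<le> p" "p \<le> 2 ^ (n - b + 1) * 2 ^ b"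
              unfolding i(2) by (intro mult_right_mono; simp)+
            moreover have "2 ^ (n - b) * 2 ^ b = (2::real) ^ n" "2 ^ (n - b + 1) * 2 ^ b = (2::real) ^ (n + 1)"
              using bn by (simp_all flip: power_add)
            ultimately show "p \<in> {2 ^ n..2 ^ (n + 1)}" by simp
          qed
          ultimately show False using no_AP ge pow_b0 by (meson order_trans)
        qed
      qed auto
      moreover have "(\<lambda>x. x div (2 ^ (u b - b) * 2 ^ t)) ` cells b = cells (u b + t)"
        unfolding cells_def image_image
      proof (rule image_cong[OF refl])
        fix x :: nat
        have "(2::nat) ^ (u b + t) = 2 ^ b * (2 ^ (u b - b) * 2 ^ t)" by (subst exp(2)) (simp only: power_add)
        thus "x div 2 ^ b div (2 ^ (u b - b) * 2 ^ t) = x div 2 ^ (u b + t)" by (simp only: div_mult2_eq)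
      qed
      ultimately show ?thesis unfolding exp(1) by (simp add: power_add)
    qed
    define \<beta> where "\<beta> j = ((\<lambda>b. u b + t) ^^ j) b\<^sub>0" for j
    have \<beta>_0: "\<beta> 0 = b\<^sub>0" and \<beta>_Suc: "\<beta> (Suc j) = u (\<beta> j) + t" for j by (simp_all add: \<beta>_def)
    have \<beta>_mono: "\<beta> j \<le> \<beta> (Suc j)" for j using b_u[of "\<beta> j"] by (simp add: \<beta>_Suc)
    have \<beta>_ge: "b\<^sub>0 \<le> \<beta> j" for j using lift_Suc_mono_le[of \<beta> 0 j] \<beta>_mono \<beta>_0 by simp
    have \<beta>_le: "real (\<beta> j) \<le> l ^ j * real b\<^sub>0" for j
    proof (induction j)
      case (Suc j)
      have "real (\<beta> (Suc j)) \<le> real (\<beta> j) / \<alpha> + (1 + real t)" using u(2)[of "\<beta> j"] by (simp add: \<beta>_Suc)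
      also have "\<dots> \<le> real (\<beta> j) / \<alpha> + real (\<beta> j) / \<alpha>"
      proof (rule add_left_mono)
        have "1 + real t \<le> real (\<beta> j)" using \<beta>_ge[of j] b0_t by linarith
        also have "\<dots> \<le> real (\<beta> j) / \<alpha>" using \<alpha> by (simp add: field_simps mult_left_le_one_le)
        finally show "1 + real t \<le> real (\<beta> j) / \<alpha>" .
      qed
      also have "\<dots> = l * real (\<beta> j)" by (simp add: l_def)
      also have "\<dots> \<le> l * (l ^ j * real b\<^sub>0)" using Suc l by (intro mult_left_mono) auto
      finally show ?case by (simp add: mult.assoc)
    qed (simp add: \<beta>_0)
    have iter: "real (card (cells b\<^sub>0)) \<le> \<epsilon> ^ j * 2 ^ (\<beta> j - b\<^sub>0) * card (cells (\<beta> j))" if "\<beta> j \<le> n" for j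
      using that
    proof (induction j)
      case (Suc j)
      have jn: "\<beta> j \<le> n" using Suc.prems \<beta>_mono[of j] by linarith
      have "real (card (cells b\<^sub>0)) \<le> \<epsilon> ^ j * 2 ^ (\<beta> j - b\<^sub>0) * card (cells (\<beta> j))" by (rule Suc.IH[OF jn])
      also have "\<dots> \<le> \<epsilon> ^ j * 2 ^ (\<beta> j - b\<^sub>0) * (\<epsilon> * 2 ^ (\<beta> (Suc j) - \<beta> j) * card (cells (\<beta> (Suc j))))"
        using step[OF \<beta>_ge[of j]] Suc.prems \<epsilon> unfolding \<beta>_Suc by (intro mult_left_mono) auto
      also have "\<dots> = \<epsilon> ^ Suc j * 2 ^ ((\<beta> j - b\<^sub>0) + (\<beta> (Suc j) - \<beta> j)) * card (cells (\<beta> (Suc j)))"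
        by (simp add: power_add)
      also have "(\<beta> j - b\<^sub>0) + (\<beta> (Suc j) - \<beta> j) = \<beta> (Suc j) - b\<^sub>0" using \<beta>_ge[of j] \<beta>_mono[of j] by linarith
      finally show ?case .
    qed (simp add: \<beta>_0)
    have bpos: "0 < real b\<^sub>0" using b0_t by simp
    have lb: "l * real b\<^sub>0 \<le> sqrt (real n)" using b0(1) l by (simp add: field_simps)
    have npos: "1 \<le> real n" using n by simp
    have "real b\<^sub>0 \<le> real n"
    proof -
      have "real b\<^sub>0 \<le> l * real b\<^sub>0" using l bpos by simp
      also have "\<dots> \<le> sqrt (real n)" by (rule lb)
      also have "\<dots> = sqrt (real n) * 1" by simp
      also have "\<dots> \<le> sqrt (real n) * sqrt (real n)" using npos by (intro mult_left_mono) auto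
      finally show ?thesis by simp
    qed
    obtain j where j: "real n / real b\<^sub>0 < l ^ j" using real_arch_pow[of l] l by fastforce
    \<comment> \<open>\<open>J\<close> satisfies
      \<open>l ^ J \<le> n / b\<^sub>0 < l ^ (J + 1)\<close>: the first inequality keeps the scale
      \<open>\<beta> J\<close> within \<open>n\<close>, the second makes the number of steps
      sufficient.\<close>
    define J where "J = (LEAST j. real n / real b\<^sub>0 < l ^ Suc j)"
    have "real n / real b\<^sub>0 < l ^ Suc j"
    proof -
      have "l ^ j \<le> l ^ Suc j" using l by (intro power_increasing) auto
      thus ?thesis using j by linarith
    qed
    hence J1: "real n / real b\<^sub>0 < l ^ Suc J" unfolding J_def by (rule LeastI)
    have J2: "l ^ J \<le> real n / real b\<^sub>0"
    proof (cases J)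
      case 0
      thus ?thesis using \<open>real b\<^sub>0 \<le> real n\<close> bpos by simp
    next
      case (Suc i)
      hence "i < (LEAST j. real n / real b\<^sub>0 < l ^ Suc j)" by (simp add: J_def)
      from not_less_Least[OF this] show ?thesis by (simp add: Suc)
    qed
    have "real (\<beta> J) \<le> l ^ J * real b\<^sub>0" by (rule \<beta>_le)
    also have "\<dots> \<le> real n" using J2 bpos by (simp add: field_simps)
    finally have \<beta>J: "\<beta> J \<le> n" by simp
    have "card (cells (\<beta> J)) \<le> card {2 ^ (n - \<beta> J)..<2 ^ (n - \<beta> J + 1) :: nat}"
      unfolding cells_def by (intro card_mono) (use div_power_bounds[OF \<beta>J] in \<open>auto simp: B_def\<close>)
    hence cells_J: "real (card (cells (\<beta> J))) \<le> 2 ^ (n - \<beta> J)" by (simp flip: of_nat_le_iff)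
    have "real (card B) \<le> real (2 ^ b\<^sub>0 * card (cells b\<^sub>0))"
      unfolding of_nat_le_iff cells_def by (rule card_le_fibres[OF finB]) simp
    also have "\<dots> = 2 ^ b\<^sub>0 * real (card (cells b\<^sub>0))" by simp
    also have "\<dots> \<le> 2 ^ b\<^sub>0 * (\<epsilon> ^ J * 2 ^ (\<beta> J - b\<^sub>0) * 2 ^ (n - \<beta> J))"
      using iter[OF \<beta>J] cells_J \<epsilon> by (intro mult_left_mono order_trans[OF iter[OF \<beta>J]]) auto
    also have "\<dots> = \<epsilon> ^ J * 2 ^ (b\<^sub>0 + (\<beta> J - b\<^sub>0) + (n - \<beta> J))" by (simp add: power_add)
    also have "b\<^sub>0 + (\<beta> J - b\<^sub>0) + (n - \<beta> J) = n" using \<beta>_ge[of J] \<beta>J by linarith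
    also have "\<epsilon> ^ J * 2 ^ n < real n powr -\<gamma> * 2 ^ n"
    proof (intro mult_strict_right_mono)
      have "sqrt (real n) * (l * real b\<^sub>0) \<le> sqrt (real n) * sqrt (real n)" using lb by (intro mult_left_mono) auto
      hence "sqrt (real n) * l \<le> real n / real b\<^sub>0" using bpos by (simp add: field_simps)
      hence "sqrt (real n) * l < l ^ J * l" using J1 by (simp add: mult.commute)
      hence sq: "sqrt (real n) < l ^ J" using l by simp
      have "\<epsilon> ^ J = (l powr real J) powr -(2 * \<gamma>)"
        using l by (simp add: \<epsilon>_def powr_powr mult.commute flip: powr_realpow[of "l powr _"])
      also have "\<dots> = (l ^ J) powr -(2 * \<gamma>)" using l by (simp add: powr_realpow)
      also have "\<dots> < (sqrt (real n)) powr -(2 * \<gamma>)" using sq npos \<gamma> by (intro powr_less_mono2_neg) auto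
      also have "\<dots> = real n powr -\<gamma>" using npos by (simp add: powr_half_sqrt[symmetric] powr_powr)
      finally show "\<epsilon> ^ J < real n powr -\<gamma>" .
    qed simp
    finally show False using dense by (simp add: B_def mult.commute)
  qed
  show ?thesis by (rule exI[of _ n\<^sub>0], intro allI impI) (rule main)
qed

section \<open>Infinitely many blocks and infinitely many progressions\<close>

theorem theorem2p1:
  fixes \<alpha> \<gamma> :: real
  assumes "\<gamma> > 0" and "0 < \<alpha>" and "\<alpha> < 1"
  shows "\<exists>c>0. \<forall>A::nat set.
    A \<subseteq> {1..} \<and>
    infinite {n::nat. n \<ge> 1 \<and> real (card (A \<inter> {0..n})) \<ge> real n / (ln (real n)) powr \<gamma>} \<longrightarrow>
    (\<forall>k::nat. \<forall>\<Delta>\<^sub>0::real. k \<ge> 1 \<and> \<Delta>\<^sub>0 > 1 \<longrightarrow>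
       infinite {P. \<exists>\<Delta>\<ge>\<Delta>\<^sub>0. approximates_AP A \<alpha> k \<Delta> P} \<and>
       infinite {n::nat. n \<ge> 1 \<and>
         (\<exists>P \<Delta>. \<Delta> \<ge> \<Delta>\<^sub>0 \<and> approximates_AP A \<alpha> k \<Delta> P \<and>
                \<Delta> \<ge> c * real n \<and> P \<subseteq> {2 ^ n .. 2 ^ (n + 1)})})"
\<comment> \<open>The gaps found are at least \<open>n\<close>, so the constant \<open>1\<close>
  serves for all \<alpha> and \<gamma>.\<close>
proof (rule exI[of _ 1], rule conjI[OF zero_less_one], intro allI impI)
  fix A :: "nat set" and k :: nat and \<Delta>\<^sub>0 :: real
  assume A: "A \<subseteq> {1..} \<and>
    infinite {n::nat. n \<ge> 1 \<and> real (card (A \<inter> {0..n})) \<ge> real n / (ln (real n)) powr \<gamma>}"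
    and k\<Delta>: "k \<ge> 1 \<and> \<Delta>\<^sub>0 > 1"
  define Q where "Q n P \<Delta> \<longleftrightarrow> \<Delta> \<ge> \<Delta>\<^sub>0 \<and> approximates_AP A \<alpha> k \<Delta> P \<and> \<Delta> \<ge> 1 * real n \<and> P \<subseteq> {2 ^ n..2 ^ (n + 1)}"
    for n P \<Delta>
  define S where "S = {n::nat. n \<ge> 1 \<and> (\<exists>P \<Delta>. Q n P \<Delta>)}"
  \<comment> \<open>Passing to dyadic blocks has cost one power of \<open>n\<close>, hence the
    exponent \<open>\<gamma> + 1\<close>.\<close>
  have "0 < \<gamma> + 1" using assms(1) by simp
  from dense_dyadic_block_approximates_AP[OF assms(2,3) this] k\<Delta> obtain n\<^sub>0 where
    "\<forall>n\<ge>n\<^sub>0. \<forall>A. real (card (A \<inter> {2 ^ n..<2 ^ (n + 1)})) \<ge> 2 ^ n * real n powr -(\<gamma> + 1) \<longrightarrow>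
    (\<exists>P \<Delta>. \<Delta> \<ge> \<Delta>\<^sub>0 \<and> approximates_AP A \<alpha> k \<Delta> P \<and> \<Delta> \<ge> real n \<and> P \<subseteq> {2 ^ n..2 ^ (n + 1)})" by metis
  note n0 = this[rule_format]
  have "{n::nat. real (card (A \<inter> {2 ^ n..<2 ^ (n + 1)})) \<ge> 2 ^ n * real n powr -(\<gamma> + 1)} - {..<max 1 n\<^sub>0} \<subseteq> S"
    using n0 by (auto simp: S_def Q_def)
  moreover have "infinite ({n::nat. real (card (A \<inter> {2 ^ n..<2 ^ (n + 1)})) \<ge> 2 ^ n * real n powr -(\<gamma> + 1)} - {..<max 1 n\<^sub>0})"
    using infinite_dense_dyadic_blocks[OF assms(1)] A by (intro Diff_infinite_finite) auto
  ultimately have S: "infinite S" using infinite_super by blast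
  have "infinite {P. \<exists>\<Delta>\<ge>\<Delta>\<^sub>0. approximates_AP A \<alpha> k \<Delta> P}"
  proof
    assume fin: "finite {P. \<exists>\<Delta>\<ge>\<Delta>\<^sub>0. approximates_AP A \<alpha> k \<Delta> P}"
    \<comment> \<open>Each nonempty \<open>P\<close> lies in \<open>{2 ^ n..2 ^ (n + 1)}\<close> for
      only finitely many \<open>n\<close>, so finitely many progressions could not serve the
      infinite set \<open>S\<close>.\<close>
    have "S \<subseteq> (\<Union>P\<in>{P. \<exists>\<Delta>\<ge>\<Delta>\<^sub>0. approximates_AP A \<alpha> k \<Delta> P}. {n. P \<noteq> {} \<and> P \<subseteq> {2 ^ n..2 ^ (n + 1)}})"
    proof
      fix n assume "n \<in> S"
      then obtain P \<Delta> where Q: "Q n P \<Delta>" by (auto simp: S_def)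
      hence "P \<noteq> {}" using k\<Delta>
        by (auto simp: Q_def approximates_AP_def is_arith_prog_def intro!: exI[of _ 0])
      thus "n \<in> (\<Union>P\<in>{P. \<exists>\<Delta>\<ge>\<Delta>\<^sub>0. approximates_AP A \<alpha> k \<Delta> P}. {n. P \<noteq> {} \<and> P \<subseteq> {2 ^ n..2 ^ (n + 1)}})"
        using Q unfolding Q_def by blast
    qed
    moreover have "finite {n::nat. P \<noteq> {} \<and> P \<subseteq> {2 ^ n..2 ^ (n + 1) :: real}}" for P
    proof (cases "P = {}")
      case False
      then obtain p where p: "p \<in> P" by blast
      obtain m :: nat where m: "p < real m" using reals_Archimedean2 by blast
      have "n < m" if "P \<subseteq> {2 ^ n..2 ^ (n + 1)}" for n
      proof -
        have "real n < 2 ^ n" by (rule of_nat_less_two_power)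
        also have "\<dots> \<le> p" using that p by auto
        finally show ?thesis using m by linarith
      qed
      hence "{n::nat. P \<noteq> {} \<and> P \<subseteq> {2 ^ n..2 ^ (n + 1) :: real}} \<subseteq> {..<m}" by blast
      thus ?thesis by (rule finite_subset) simp
    qed simp
    ultimately have "finite S" using fin by (meson finite_UN_I finite_subset)
    thus False using S by blast
  qed
  thus "infinite {P. \<exists>\<Delta>\<ge>\<Delta>\<^sub>0. approximates_AP A \<alpha> k \<Delta> P} \<and>
       infinite {n::nat. n \<ge> 1 \<and>
         (\<exists>P \<Delta>. \<Delta> \<ge> \<Delta>\<^sub>0 \<and> approximates_AP A \<alpha> k \<Delta> P \<and>
                \<Delta> \<ge> 1 * real n \<and> P \<subseteq> {2 ^ n .. 2 ^ (n + 1)})}"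
    using S unfolding S_def Q_def by blast
qed

end
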